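(* Let $\varphi\in L^{2}(\mathbb{R}^{2n})$ satisfy condition C and $\frac{1}{w_{\varphi}}\in L^{1}(\mathbb{T}^{n})$. Assume that $\|w_{\varphi}\|_{\infty}<\infty$. Then $\{T^{t}_{(k,l)}\varphi:(k,l)\in\mathbb{Z}^{2n}\}$ is Hilbertian.
   Context: $\mathbb{T}^{n}$ is identified with $[0,1)^{n}$ with Lebesgue measure; $\|\cdot\|_\infty$ is the $L^{\infty}(\mathbb{T}^{n})$ norm. Twisted translation: for $\varphi\in L^{2}(\mathbb{R}^{2n})$ and $(k,l)\in\mathbb{Z}^{2n}$ (with $k,l\in\mathbb{Z}^n$), $T^{t}_{(k,l)}\varphi(x,y)=e^{\pi i(x\cdot l-y\cdot k)}\varphi(x-k,y-l)$, $(x,y)\in\mathbb{R}^{n}\times\mathbb{R}^{n}$. Kernel of the Weyl transform: for $f\in L^{2}(\mathbb{R}^{2n})$, $K_{f}(\xi,\eta)=\int_{\mathbb{R}^{n}}f(x,\eta-\xi)e^{i\pi x\cdot(\xi+\eta)}dx$ (interpreted in the $L^{2}$ sense as a partial Fourier transform; $f\mapsto K_f$ is an isometry of $L^{2}(\mathbb{R}^{2n})$). $w_{\varphi}(\xi)=\sum_{m\in\mathbb{Z}^{n}}\int_{\mathbb{R}^{n}}|K_{\varphi}(\xi+m,\eta)|^{2}d\eta$ for $\xi\in\mathbb{R}^{n}$; this is $\mathbb{Z}^{n}$-periodic and is regarded also as a function on $\mathbb{T}^{n}$; $1/w_\varphi$ is $+\infty$ where $w_\varphi=0$. Condition C: $\varphi$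 satisfies condition C if for every $l\in\mathbb{Z}^{n}\setminus\{0\}$, $\sum_{m\in\mathbb{Z}^{n}}\int_{\mathbb{R}^{n}}K_{\varphi}(\xi+m,\eta)\overline{K_{\varphi}(\xi+m+l,\eta)}\,d\eta=0$ for a.e. $\xi\in\mathbb{T}^{n}$. A family $\{f_{j}:j\in\mathbb{Z}^{d}\}$ in a Hilbert space $\mathcal{H}$ is Hilbertian if $\{c_{j}\}\in\ell^{2}(\mathbb{Z}^{d})$ implies that $\sum_{j\in\mathbb{Z}^{d}}c_{j}f_{j}$ converges. Convergence of a series over $\mathbb{Z}^{d}$ means norm convergence in $\mathcal{H}$ of the partial sums over $\{j:\max_i|j_i|\le N\}$ as $N\to\infty$. *)

theory Defs
  imports "HOL-Analysis.Analysis" "HOL-Probability.Essential_Supremum"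
begin

text \<open>
  Elements of \<open>L\<^sup>2(M)\<close> are represented by measurable functions, with \<open>norm_L2\<close> as a seminorm.
  All functions on \<open>\<real>\<^sup>n\<close> and \<open>\<real>\<^sup>2\<^sup>n\<close> are Borel representatives of their classes.
\<close>

definition L2_space :: "'a measure \<Rightarrow> ('a \<Rightarrow> complex) set" where
  "L2_space M = {f \<in> borel_measurable M. integrable M (\<lambda>x. (cmod (f x))\<^sup>2)}"

definition norm_L2 :: "'a measure \<Rightarrow> ('a \<Rightarrow> complex) \<Rightarrow> real" where
  "norm_L2 M f = sqrt (\<integral>x. (cmod (f x))\<^sup>2 \<partial>M)"

definition tendsto_L2 ::
    "'a measure \<Rightarrow> ('b \<Rightarrow> 'a \<Rightarrow> complex) \<Rightarrow> ('a \<Rightarrow> complex) \<Rightarrow> 'b filter \<Rightarrow> bool" where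
  "tendsto_L2 M F f flt \<longleftrightarrow>
     (\<forall>r. F r \<in> L2_space M) \<and> f \<in> L2_space M \<and>
     ((\<lambda>r. norm_L2 M (\<lambda>x. F r x - f x)) \<longlongrightarrow> 0) flt"

definition int_cube :: "nat \<Rightarrow> (int ^ 'd) set" where
  "int_cube N = {j. \<forall>i. \<bar>j $ i\<bar> \<le> int N}"

definition hilbertian :: "'a measure \<Rightarrow> (int ^ 'd \<Rightarrow> 'a \<Rightarrow> complex) \<Rightarrow> bool" where
  "hilbertian M f \<longleftrightarrow>
     (\<forall>j. f j \<in> L2_space M) \<and>
     (\<forall>c :: int ^ 'd \<Rightarrow> complex. (\<lambda>j. (cmod (c j))\<^sup>2) summable_on UNIV \<longrightarrow>
        (\<exists>g. tendsto_L2 M (\<lambda>N x. \<Sum>j\<in>int_cube N. c j * f j x) g sequentially))"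

definition real_vec :: "int ^ 'n \<Rightarrow> real ^ 'n" where
  "real_vec k = (\<chi> i. real_of_int (k $ i))"

definition torus :: "(real ^ 'n) measure" where
  "torus = restrict_space lborel {x. \<forall>i. 0 \<le> x $ i \<and> x $ i < 1}"

definition twisted_translation ::
    "(int ^ 'n) \<times> (int ^ 'n) \<Rightarrow> ((real ^ 'n) \<times> (real ^ 'n) \<Rightarrow> complex)
      \<Rightarrow> (real ^ 'n) \<times> (real ^ 'n) \<Rightarrow> complex" where
  "twisted_translation = (\<lambda>(k, l) f (x, y).
     cis (pi * (x \<bullet> real_vec l - y \<bullet> real_vec k)) * f (x - real_vec k, y - real_vec l))"

text \<open>
  For \<open>f\<close> in \<open>L\<^sup>2(\<real>\<^sup>2\<^sup>n)\<close> the integral defining \<open>K\<^sub>f\<close> need not converge absolutely; as usual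
  for the Fourier transform on \<open>L\<^sup>2\<close>, \<open>K\<^sub>f\<close> is the \<open>L\<^sup>2\<close>-limit of the integrals over the balls
  \<open>\<parallel>x\<parallel> \<le> R\<close>. The limit exists by the Plancherel theorem and is unique up to null sets, so it
  does not matter which representative \<open>SOME\<close> picks.
\<close>

definition weyl_kernel_truncated ::
    "((real ^ 'n) \<times> (real ^ 'n) \<Rightarrow> complex) \<Rightarrow> real \<Rightarrow> (real ^ 'n) \<times> (real ^ 'n) \<Rightarrow> complex" where
  "weyl_kernel_truncated f R = (\<lambda>(\<xi>, \<eta>).
     LINT x:cball 0 R|lborel. f (x, \<eta> - \<xi>) * cis (pi * (x \<bullet> (\<xi> + \<eta>))))"

definition weyl_kernel ::
    "((real ^ 'n) \<times> (real ^ 'n) \<Rightarrow> complex) \<Rightarrow> (real ^ 'n) \<times> (real ^ 'n) \<Rightarrow> complex" where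
  "weyl_kernel f = (SOME K. tendsto_L2 lborel (weyl_kernel_truncated f) K at_top)"

definition w_fun :: "((real ^ 'n) \<times> (real ^ 'n) \<Rightarrow> complex) \<Rightarrow> real ^ 'n \<Rightarrow> ennreal" where
  "w_fun f \<xi> = (\<Sum>\<^sub>\<infinity>m :: int ^ 'n.
     \<integral>\<^sup>+\<eta>. ennreal ((cmod (weyl_kernel f (\<xi> + real_vec m, \<eta>)))\<^sup>2) \<partial>lborel)"

definition condition_C :: "((real ^ 'n) \<times> (real ^ 'n) \<Rightarrow> complex) \<Rightarrow> bool" where
  "condition_C f \<longleftrightarrow> (\<forall>l :: int ^ 'n. l \<noteq> 0 \<longrightarrow>
     (AE \<xi> in torus.
        ((\<lambda>m :: int ^ 'n. \<integral>\<eta>. weyl_kernel f (\<xi> + real_vec m, \<eta>)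
             * cnj (weyl_kernel f (\<xi> + real_vec m + real_vec l, \<eta>)) \<partial>lborel)
           has_sum 0) UNIV))"

text \<open>
  For \<open>[0,\<infinity>]\<close>-valued functions; in \<open>ennreal\<close>, \<open>1 / 0 = \<infinity>\<close>, as required for \<open>1 / w\<close>.
\<close>

definition L1_ennreal :: "'a measure \<Rightarrow> ('a \<Rightarrow> ennreal) \<Rightarrow> bool" where
  "L1_ennreal M g \<longleftrightarrow> g \<in> borel_measurable M \<and> (\<integral>\<^sup>+x. g x \<partial>M) < \<infinity>"

end

theory Submission
  imports Defs "HOL-Probability.Characteristic_Functions"
begin

text \<open>
  Write \<open>T\<^sub>p\<close> for the twisted translation by \<open>p = (k, l)\<close>. The theorem follows from a Bessel bound
  \<open>\<parallel>\<Sum>\<^sub>p c\<^sub>p T\<^sub>p \<phi>\<parallel>\<^sup>2 \<le> \<parallel>w\<parallel>\<^sub>\<infinity> \<Sum>\<^sub>p |c\<^sub>p|\<^sup>2\<close> for finite sums (\<open>twisted_translation_Bessel\<close>): with square summable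
  coefficients it makes the partial sums over cubes Cauchy, and \<open>L\<^sup>2\<close> is complete (\<open>L2_complete\<close>,
  \<open>hilbertian_of_Bessel\<close>).

  The bound is read off on the side of the Weyl kernel \<open>K\<close> of \<open>\<phi>\<close>. The map from a function to its Weyl kernel is
  an isometry. It is a Fourier transform in the first variable followed by a measure preserving change of
  variables, so that this rests on the Plancherel theorem in \<open>\<real>\<^sup>n\<close>, which is proved here by Gaussian
  regularisation (\<open>Plancherel\<close>, \<open>energy_weyl_integral\<close>). The isometry also shows that the limit defining \<open>K\<close>
  exists (\<open>weyl_kernel_tendsto\<close>). The map carries \<open>T\<^bsub>(k, l)\<^esub> \<phi>\<close> to
  \<open>exp(\<pi>i (k \<bullet> l + 2 k \<bullet> \<xi>)) K(\<xi> + l, \<eta>)\<close>. Hence the norm of \<open>\<Sum>\<^sub>p c\<^sub>p T\<^sub>p \<phi>\<close> is that of \<open>\<Sum>\<^sub>l P\<^sub>l(\<xi>) K(\<xi> + l, \<eta>)\<close>, where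
  \<open>P\<^sub>l\<close> is a trigonometric polynomial whose coefficients are, up to unimodular factors, the \<open>c\<^bsub>(k, l)\<^esub>\<close>
  (\<open>norm_L2_sum_twisted_translation\<close>, \<open>sum_kernel_shift_eq_layers\<close>).

  Now split the integral over \<open>\<xi>\<close> in \<open>\<real>\<^sup>n\<close> into an integral over the torus and a sum over the integer translates
  of \<open>\<xi>\<close> (\<open>nn_integral_lborel_periodize\<close>). On such an orbit the \<open>P\<^sub>l\<close> are constant. Condition C says
  exactly that the shifts of \<open>K\<close> by different \<open>l\<close> are orthogonal on almost every orbit, and each of them has
  squared norm \<open>w(\<xi>)\<close> there. By the Pythagorean theorem (\<open>orthogonal_translates_energy\<close>) the squared norm is therefore
  the integral of \<open>w \<Sum>\<^sub>l |P\<^sub>l|\<^sup>2\<close> over the torus. This is at most \<open>\<parallel>w\<parallel>\<^sub>\<infinity>\<close> times the integral of \<open>\<Sum>\<^sub>l |P\<^sub>l|\<^sup>2\<close>, which by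
  Parseval (\<open>energy_torus_trigonometric_le\<close>) is at most \<open>\<Sum>\<^sub>p |c\<^sub>p|\<^sup>2\<close>.
\<close>

section \<open>The Hilbert space of square integrable functions\<close>

text \<open>
  The square of the \<open>L\<^sup>2\<close> norm as a number in \<open>[0,\<infinity>]\<close>: it makes sense for every measurable function and
  obeys the theorems of Tonelli and Fatou without a prior proof of integrability.
\<close>

definition energy :: "'a measure \<Rightarrow> ('a \<Rightarrow> complex) \<Rightarrow> ennreal" where
  "energy M f = (\<integral>\<^sup>+x. ennreal ((cmod (f x))\<^sup>2) \<partial>M)"

lemma borel_measurable_cnj [measurable (raw)]:
  "f \<in> borel_measurable M \<Longrightarrow> (\<lambda>x. cnj (f x)) \<in> borel_measurable M"
  by (rule borel_measurable_continuous_on[OF _ , of cnj]) (auto intro!: continuous_intros)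

lemma L2_space_iff_energy: "f \<in> L2_space M \<longleftrightarrow> f \<in> borel_measurable M \<and> energy M f < \<infinity>"
  unfolding L2_space_def energy_def by (auto simp: integrable_iff_bounded)

lemma L2_spaceD [measurable_dest]: "f \<in> L2_space M \<Longrightarrow> f \<in> borel_measurable M"
  by (simp add: L2_space_def)

lemma energy_eq_norm_L2:
  assumes "f \<in> L2_space M" shows "energy M f = ennreal ((norm_L2 M f)\<^sup>2)"
  using assms unfolding energy_def norm_L2_def L2_space_def
  by (simp add: nn_integral_eq_integral)

lemma norm_L2_nonneg [simp]: "0 \<le> norm_L2 M f"
  by (simp add: norm_L2_def)

lemma norm_L2_le_iff:
  assumes "f \<in> L2_space M" "0 \<le> b" shows "norm_L2 M f \<le> b \<longleftrightarrow> energy M f \<le> ennreal (b\<^sup>2)"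
  using assms by (simp add: energy_eq_norm_L2 power_mono_iff)

lemma energy_le_imp_L2:
  assumes "f \<in> borel_measurable M" "energy M f \<le> ennreal b"
  shows "f \<in> L2_space M"
  using assms by (auto simp: L2_space_iff_energy intro: le_less_trans)

lemma
  assumes f: "f \<in> L2_space M" and g: "g \<in> L2_space M"
  shows L2_product_integrable: "integrable M (\<lambda>x. f x * cnj (g x))"
    and L2_Cauchy_Schwarz: "(\<integral>x. cmod (f x) * cmod (g x) \<partial>M) \<le> norm_L2 M f * norm_L2 M g"
    and L2_Cauchy_Schwarz_nn: "(\<integral>\<^sup>+x. ennreal (cmod (f x) * cmod (g x)) \<partial>M) \<le> ennreal (norm_L2 M f * norm_L2 M g)"
proof -
  note [measurable] = L2_spaceD[OF f] L2_spaceD[OF g]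
  define I where "I = (\<integral>\<^sup>+x. ennreal (cmod (f x) * cmod (g x)) \<partial>M)"
  have "I\<^sup>2 \<le> energy M f * energy M g"
    using Cauchy_Schwarz_nn_integral[of "\<lambda>x. ennreal (cmod (f x))" M "\<lambda>x. ennreal (cmod (g x))"]
    unfolding I_def energy_def by (simp add: ennreal_mult ennreal_power)
  also have "\<dots> = ennreal ((norm_L2 M f * norm_L2 M g)\<^sup>2)"
    using f g by (simp add: energy_eq_norm_L2 ennreal_mult power_mult_distrib)
  finally have I2: "I\<^sup>2 \<le> ennreal ((norm_L2 M f * norm_L2 M g)\<^sup>2)" .
  show I: "I \<le> ennreal (norm_L2 M f * norm_L2 M g)"
  proof (cases I)
    case (real r)
    then have "r\<^sup>2 \<le> (norm_L2 M f * norm_L2 M g)\<^sup>2"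
      using I2 by (simp add: ennreal_power)
    then have "r \<le> norm_L2 M f * norm_L2 M g" by (rule power2_le_imp_le) simp
    then show ?thesis using real by (simp add: ennreal_leI)
  next
    case top
    then show ?thesis using I2 by (simp add: power2_eq_square top_unique ennreal_mult_eq_top_iff)
  qed
  have "I < \<infinity>" using I le_less_trans by fastforce
  then have int: "integrable M (\<lambda>x. cmod (f x) * cmod (g x))"
    unfolding I_def by (simp add: integrable_iff_bounded)
  then show "integrable M (\<lambda>x. f x * cnj (g x))"
    by (subst integrable_norm_iff[symmetric]) (auto simp: norm_mult)
  have "ennreal (\<integral>x. cmod (f x) * cmod (g x) \<partial>M) = I"
    unfolding I_def by (rule nn_integral_eq_integral[OF int, symmetric]) simp
  then show "(\<integral>x. cmod (f x) * cmod (g x) \<partial>M) \<le> norm_L2 M f * norm_L2 M g"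
    using I by (metis ennreal_le_iff mult_nonneg_nonneg norm_L2_nonneg)
qed

lemma
  assumes f: "f \<in> L2_space M" and g: "g \<in> L2_space M"
  shows L2_add: "(\<lambda>x. f x + g x) \<in> L2_space M"
    and norm_L2_triangle: "norm_L2 M (\<lambda>x. f x + g x) \<le> norm_L2 M f + norm_L2 M g"
proof -
  note [measurable] = L2_spaceD[OF f] L2_spaceD[OF g]
  have "energy M (\<lambda>x. f x + g x) \<le> (\<integral>\<^sup>+x. ennreal ((cmod (f x))\<^sup>2) + 2 * ennreal (cmod (f x) * cmod (g x)) + ennreal ((cmod (g x))\<^sup>2) \<partial>M)"
    unfolding energy_def
  proof (rule nn_integral_mono)
    fix x
    have "(cmod (f x + g x))\<^sup>2 \<le> (cmod (f x) + cmod (g x))\<^sup>2"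
      by (intro power_mono norm_triangle_ineq) simp
    also have "\<dots> = (cmod (f x))\<^sup>2 + 2 * (cmod (f x) * cmod (g x)) + (cmod (g x))\<^sup>2"
      by (simp add: power2_eq_square algebra_simps)
    finally have "ennreal ((cmod (f x + g x))\<^sup>2) \<le> ennreal ((cmod (f x))\<^sup>2 + 2 * (cmod (f x) * cmod (g x)) + (cmod (g x))\<^sup>2)"
      by (rule ennreal_leI)
    then show "ennreal ((cmod (f x + g x))\<^sup>2) \<le> ennreal ((cmod (f x))\<^sup>2) + 2 * ennreal (cmod (f x) * cmod (g x)) + ennreal ((cmod (g x))\<^sup>2)"
      by (simp add: ennreal_mult)
  qed
  also have "\<dots> = energy M f + 2 * (\<integral>\<^sup>+x. ennreal (cmod (f x) * cmod (g x)) \<partial>M) + energy M g"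
    unfolding energy_def by (simp add: nn_integral_add nn_integral_cmult)
  also have "\<dots> \<le> energy M f + 2 * ennreal (norm_L2 M f * norm_L2 M g) + energy M g"
    by (intro add_mono mult_left_mono L2_Cauchy_Schwarz_nn f g) auto
  also have "\<dots> = ennreal ((norm_L2 M f + norm_L2 M g)\<^sup>2)"
    unfolding energy_eq_norm_L2[OF f] energy_eq_norm_L2[OF g] power2_sum
    by (simp add: ennreal_mult' algebra_simps)
  finally have *: "energy M (\<lambda>x. f x + g x) \<le> ennreal ((norm_L2 M f + norm_L2 M g)\<^sup>2)" .
  then show L: "(\<lambda>x. f x + g x) \<in> L2_space M"
    by (intro energy_le_imp_L2) measurable
  show "norm_L2 M (\<lambda>x. f x + g x) \<le> norm_L2 M f + norm_L2 M g"
    using * by (subst norm_L2_le_iff[OF L]) auto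
qed

lemma energy_mult_const:
  "f \<in> borel_measurable M \<Longrightarrow> energy M (\<lambda>x. c * f x) = ennreal ((cmod c)\<^sup>2) * energy M f"
  unfolding energy_def by (simp add: norm_mult power_mult_distrib ennreal_mult nn_integral_cmult)

lemma L2_cmult: "f \<in> L2_space M \<Longrightarrow> (\<lambda>x. c * f x) \<in> L2_space M"
  by (auto simp: L2_space_iff_energy energy_mult_const ennreal_mult_less_top)

lemma L2_zero [simp]: "(\<lambda>x. 0) \<in> L2_space M"
  by (simp add: L2_space_iff_energy energy_def)

lemma L2_sum:
  assumes "\<And>i. i \<in> I \<Longrightarrow> f i \<in> L2_space M"
  shows "(\<lambda>x. \<Sum>i\<in>I. f i x) \<in> L2_space M"
  using assms by (induction I rule: infinite_finite_induct) (auto intro!: L2_add)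

lemma L2_diff:
  assumes "f \<in> L2_space M" "g \<in> L2_space M"
  shows "(\<lambda>x. f x - g x) \<in> L2_space M"
  using L2_add[OF assms(1) L2_cmult[OF assms(2), of "-1"]] by simp

lemma norm_L2_minus_commute: "norm_L2 M (\<lambda>x. f x - g x) = norm_L2 M (\<lambda>x. g x - f x)"
  by (simp add: norm_L2_def norm_minus_commute)

lemma norm_L2_triangle_diff:
  assumes "f \<in> L2_space M" "g \<in> L2_space M" "h \<in> L2_space M"
  shows "norm_L2 M (\<lambda>x. f x - h x) \<le> norm_L2 M (\<lambda>x. f x - g x) + norm_L2 M (\<lambda>x. g x - h x)"
  using norm_L2_triangle[OF L2_diff[OF assms(1,2)] L2_diff[OF assms(2,3)]] by simp

text \<open>
  With the roles of \<open>f\<close> and \<open>g\<close> exchanged this gives the reverse triangle inequality, hence the continuity of the norm.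
\<close>

lemma norm_L2_le_add_diff:
  assumes "f \<in> L2_space M" "g \<in> L2_space M"
  shows "norm_L2 M f \<le> norm_L2 M g + norm_L2 M (\<lambda>x. f x - g x)"
  using norm_L2_triangle[OF assms(2) L2_diff[OF assms]] by simp

lemma L2_Fatou:
  assumes [measurable]: "\<And>n. f n \<in> borel_measurable M" "g \<in> borel_measurable M"
    and lim: "AE x in M. (\<lambda>n. f n x) \<longlonglongrightarrow> g x"
    and le: "\<forall>\<^sub>F n in sequentially. energy M (f n) \<le> b"
  shows "energy M g \<le> b"
proof -
  have "energy M g = (\<integral>\<^sup>+x. liminf (\<lambda>n. ennreal ((cmod (f n x))\<^sup>2)) \<partial>M)"
    unfolding energy_def
  proof (rule nn_integral_cong_AE, use lim in eventually_elim)
    fix x assume "(\<lambda>n. f n x) \<longlonglongrightarrow> g x"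
    then have "(\<lambda>n. ennreal ((cmod (f n x))\<^sup>2)) \<longlonglongrightarrow> ennreal ((cmod (g x))\<^sup>2)"
      by (intro tendsto_ennrealI tendsto_intros)
    then show "ennreal ((cmod (g x))\<^sup>2) = liminf (\<lambda>n. ennreal ((cmod (f n x))\<^sup>2))"
      by (intro lim_imp_Liminf[symmetric]) auto
  qed
  also have "\<dots> \<le> liminf (\<lambda>n. energy M (f n))"
    unfolding energy_def by (rule nn_integral_liminf) measurable
  also have "\<dots> \<le> limsup (\<lambda>n. energy M (f n))"
    by (rule Liminf_le_Limsup) simp
  also have "\<dots> \<le> b"
    by (rule Limsup_bounded) (use le in simp)
  finally show ?thesis .
qed

text \<open>
  Riesz--Fischer. A rapidly Cauchy subsequence converges almost everywhere, because its increments are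
  almost everywhere summable; Fatou's lemma then bounds the distance of every late term from the pointwise limit.
\<close>

theorem L2_complete:
  assumes F: "\<And>n. F n \<in> L2_space M"
    and Cauchy: "\<And>e. 0 < e \<Longrightarrow> \<exists>N. \<forall>m\<ge>N. \<forall>n\<ge>N. norm_L2 M (\<lambda>x. F m x - F n x) \<le> e"
  shows "\<exists>g. g \<in> L2_space M \<and> (\<lambda>n. norm_L2 M (\<lambda>x. F n x - g x)) \<longlonglongrightarrow> 0"
proof -
  note [measurable] = L2_spaceD[OF F]
  have "\<exists>N. \<forall>k. \<forall>m\<ge>N k. \<forall>n\<ge>N k. norm_L2 M (\<lambda>x. F m x - F n x) \<le> (1/2)^k"
    by (rule choice, rule allI, rule Cauchy) simp
  then obtain N where N: "\<And>k m n. m \<ge> N k \<Longrightarrow> n \<ge> N k \<Longrightarrow> norm_L2 M (\<lambda>x. F m x - F n x) \<le> (1/2)^k"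
    by metis
  define r where "r k = k + (\<Sum>i\<le>k. N i)" for k
  have rN: "N k \<le> r k" for k unfolding r_def by (simp add: trans_le_add2 member_le_sum)
  have rmono: "r k \<le> r (Suc k)" for k unfolding r_def by simp
  define d where "d k x = F (r (Suc k)) x - F (r k) x" for k x
  have [measurable]: "d k \<in> borel_measurable M" for k unfolding d_def by measurable
  have ed: "energy M (d k) \<le> ennreal ((1/4)^k)" for k
  proof -
    have "norm_L2 M (d k) \<le> (1/2)^k"
      unfolding d_def by (intro N) (use rN rmono order_trans in blast)+
    moreover have "d k \<in> L2_space M" unfolding d_def by (intro L2_diff F)
    ultimately have "energy M (d k) \<le> ennreal (((1/2)^k)\<^sup>2)"
      by (simp add: norm_L2_le_iff)
    also have "((1/2)^k)\<^sup>2 = ((1/4)^k :: real)" by (simp add: power2_eq_square flip: power_mult_distrib)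
    finally show ?thesis .
  qed
  \<comment> \<open>the weights \<open>2^k\<close> keep the sum of the energies finite, so that the increments decay geometrically almost everywhere\<close>
  have "(\<integral>\<^sup>+x. (\<Sum>k. ennreal (2^k * (cmod (d k x))\<^sup>2)) \<partial>M) = (\<Sum>k. \<integral>\<^sup>+x. ennreal (2^k * (cmod (d k x))\<^sup>2) \<partial>M)"
    by (rule nn_integral_suminf) measurable
  also have "\<dots> \<le> (\<Sum>k. ennreal ((1/2)^k))"
  proof (rule suminf_le)
    fix k
    have "(\<integral>\<^sup>+x. ennreal (2^k * (cmod (d k x))\<^sup>2) \<partial>M) = ennreal (2^k) * energy M (d k)"
      unfolding energy_def by (simp add: ennreal_mult nn_integral_cmult del: ennreal_power)
    also have "\<dots> \<le> ennreal (2^k) * ennreal ((1/4)^k)"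
      by (intro mult_left_mono ed) simp
    also have "\<dots> = ennreal ((1/2)^k)"
      by (simp add: ennreal_mult'[symmetric] flip: power_mult_distrib)
    finally show "(\<integral>\<^sup>+x. ennreal (2^k * (cmod (d k x))\<^sup>2) \<partial>M) \<le> ennreal ((1/2)^k)" .
  qed auto
  also have "\<dots> < \<infinity>"
    by (simp add: suminf_ennreal2 summable_geometric)
  finally have fin: "AE x in M. (\<Sum>k. ennreal (2^k * (cmod (d k x))\<^sup>2)) \<noteq> \<infinity>"
    by (intro nn_integral_noteq_infinite) auto
  define G where "G x = lim (\<lambda>k. F (r k) x)" for x
  have [measurable]: "G \<in> borel_measurable M" unfolding G_def by measurable
  have conv: "AE x in M. (\<lambda>k. F (r k) x) \<longlonglongrightarrow> G x"
    using fin
  proof eventually_elim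
    fix x assume "(\<Sum>k. ennreal (2^k * (cmod (d k x))\<^sup>2)) \<noteq> \<infinity>"
    then have S: "summable (\<lambda>k. 2^k * (cmod (d k x))\<^sup>2)"
      by (intro summable_suminf_not_top) auto
    define q where "q = 1 / sqrt 2"
    have q: "0 \<le> q" "q < 1" "q\<^sup>2 = 1/2" unfolding q_def by (auto simp: power_divide)
    have "summable (\<lambda>k. cmod (d k x))"
    proof (rule summable_comparison_test')
      show "summable (\<lambda>k. 2^k * (cmod (d k x))\<^sup>2 + (1/2)^k)"
        by (intro summable_add S) (simp add: summable_geometric)
      fix k assume "k \<ge> (0::nat)"
      have eq: "(2::real)^k * (1/2)^k = 1" by (simp flip: power_mult_distrib)
      show "norm (cmod (d k x)) \<le> 2^k * (cmod (d k x))\<^sup>2 + (1/2)^k"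
      proof (cases "(1/2)^k \<le> cmod (d k x)")
        case True
        then have "2^k * (1/2)^k * cmod (d k x) \<le> 2^k * cmod (d k x) * cmod (d k x)"
          by (intro mult_right_mono mult_left_mono) auto
        then show ?thesis using eq by (simp add: power2_eq_square add_increasing2)
      qed (simp add: add_increasing)
    qed
    then have "summable (\<lambda>k. d k x)" by (rule summable_norm_cancel)
    then have "(\<lambda>n. \<Sum>k<n. d k x) \<longlonglongrightarrow> (\<Sum>k. d k x)" by (rule summable_LIMSEQ)
    then have "(\<lambda>n. F (r n) x - F (r 0) x) \<longlonglongrightarrow> (\<Sum>k. d k x)"
      using sum_lessThan_telescope[of "\<lambda>k. F (r k) x"] by (simp add: d_def)
    then have "(\<lambda>n. (F (r n) x - F (r 0) x) + F (r 0) x) \<longlonglongrightarrow> (\<Sum>k. d k x) + F (r 0) x"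
      by (intro tendsto_intros)
    then show "(\<lambda>k. F (r k) x) \<longlonglongrightarrow> G x"
      unfolding G_def by (intro convergent_LIMSEQ_iff[THEN iffD1]) (auto simp: convergent_def)
  qed
  have tail: "energy M (\<lambda>x. F n x - G x) \<le> ennreal (((1/2)^k)\<^sup>2)" if "n \<ge> N k" for n k
  proof (rule L2_Fatou[where f = "\<lambda>j x. F n x - F (r j) x"])
    show "AE x in M. (\<lambda>j. F n x - F (r j) x) \<longlonglongrightarrow> F n x - G x"
      using conv by eventually_elim (intro tendsto_intros)
    have "energy M (\<lambda>x. F n x - F (r j) x) \<le> ennreal (((1/2)^k)\<^sup>2)" if "j \<ge> k" for j
    proof -
      have "N k \<le> r j" using lift_Suc_mono_le[of r, OF rmono that] rN[of k] by linarith
      then show ?thesis using N[OF \<open>n \<ge> N k\<close>]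
        by (subst norm_L2_le_iff[symmetric]) (auto intro!: L2_diff F)
    qed
    then show "\<forall>\<^sub>F j in sequentially. energy M (\<lambda>x. F n x - F (r j) x) \<le> ennreal (((1/2)^k)\<^sup>2)"
      by (rule eventually_sequentiallyI)
  qed measurable
  have diffL2: "(\<lambda>x. F n x - G x) \<in> L2_space M" if "n \<ge> N 0" for n
    by (rule energy_le_imp_L2[OF _ tail[OF that]]) measurable
  have G: "G \<in> L2_space M"
    using L2_diff[OF F[of "N 0"] diffL2[OF order_refl]] by simp
  have "(\<lambda>n. norm_L2 M (\<lambda>x. F n x - G x)) \<longlonglongrightarrow> 0"
  proof (rule LIMSEQ_I)
    fix e :: real assume "0 < e"
    then obtain k where k: "(1/2)^k < e" using real_arch_pow_inv[of e "1/2"] by auto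
    have "norm_L2 M (\<lambda>x. F n x - G x) < e" if "n \<ge> N k" for n
    proof -
      have "norm_L2 M (\<lambda>x. F n x - G x) \<le> (1/2)^k"
        using tail[OF that] by (subst norm_L2_le_iff) (auto intro!: L2_diff F G)
      with k show ?thesis by simp
    qed
    then show "\<exists>n0. \<forall>n\<ge>n0. norm (norm_L2 M (\<lambda>x. F n x - G x) - 0) < e" by auto
  qed
  with G show ?thesis by blast
qed

section \<open>Translations and dilations of Lebesgue measure\<close>

lemma lborel_translate: "distr lborel borel (\<lambda>x. x + a) = (lborel :: 'a::euclidean_space measure)"
  using lborel_distr_plus[of a] by (simp add: add.commute cong: distr_cong)

lemma nn_integral_lborel_translate:
  fixes f :: "'a::euclidean_space \<Rightarrow> ennreal"
  assumes [measurable]: "f \<in> borel_measurable borel"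
  shows "(\<integral>\<^sup>+x. f (x + a) \<partial>lborel) = (\<integral>\<^sup>+x. f x \<partial>lborel)"
  by (subst (2) lborel_translate[of a, symmetric]) (simp add: nn_integral_distr)

lemma lborel_integrable_translate:
  fixes f :: "'a::euclidean_space \<Rightarrow> 'b::{banach, second_countable_topology}"
  assumes "integrable lborel f"
  shows "integrable lborel (\<lambda>x. f (x + a))"
  using assms
  by (subst (asm) lborel_translate[of a, symmetric]) (rule integrable_distr, auto)

lemma lborel_integral_translate:
  fixes f :: "'a::euclidean_space \<Rightarrow> 'b::{banach, second_countable_topology}"
  assumes [measurable]: "f \<in> borel_measurable borel"
  shows "(\<integral>x. f (x + a) \<partial>lborel) = (\<integral>x. f x \<partial>lborel)"
  by (subst (2) lborel_translate[of a, symmetric]) (simp add: integral_distr)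

lemma lborel_AE_translate:
  fixes a :: "'a::euclidean_space"
  assumes "AE x in lborel. P x" shows "AE x in lborel. P (x + a)"
  using assms by (subst (asm) lborel_translate[of a, symmetric]) (rule AE_distrD, auto)

lemma energy_translate:
  fixes f :: "'a::euclidean_space \<Rightarrow> complex"
  assumes [measurable]: "f \<in> borel_measurable borel"
  shows "energy lborel (\<lambda>x. f (x + a)) = energy lborel f"
  unfolding energy_def by (rule nn_integral_lborel_translate) measurable

lemma L2_translate:
  fixes f :: "'a::euclidean_space \<Rightarrow> complex"
  assumes "f \<in> L2_space lborel" shows "(\<lambda>x. f (x + a)) \<in> L2_space lborel"
  using assms energy_translate[of f a] by (auto simp: L2_space_iff_energy)

lemma norm_L2_translate:
  fixes f :: "'a::euclidean_space \<Rightarrow> complex"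
  assumes "f \<in> borel_measurable borel"
  shows "norm_L2 lborel (\<lambda>x. f (x + a)) = norm_L2 lborel f"
proof -
  note [measurable] = assms
  show ?thesis
    unfolding norm_L2_def by (subst lborel_integral_translate[where a = a and f = "\<lambda>x. (cmod (f x))\<^sup>2"]) auto
qed

lemma lborel_integral_scale:
  fixes f :: "'a::euclidean_space \<Rightarrow> 'b::{banach, second_countable_topology}"
  assumes [measurable]: "f \<in> borel_measurable borel" and c: "c \<noteq> 0"
  shows "(\<integral>x. f x \<partial>lborel) = \<bar>c\<bar>^DIM('a) *\<^sub>R (\<integral>x. f (c *\<^sub>R x) \<partial>lborel)"
proof -
  have "(\<integral>x. f x \<partial>lborel) = (\<integral>x. f x \<partial>density (distr lborel borel (\<lambda>x. c *\<^sub>R x)) (\<lambda>_. ennreal (\<bar>c\<bar>^DIM('a))))"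
    by (subst lborel_affine[OF c, of 0]) (simp add: ennreal_power)
  also have "\<dots> = (\<integral>x. \<bar>c\<bar>^DIM('a) *\<^sub>R f (c *\<^sub>R x) \<partial>lborel)"
    by (subst integral_density) (auto simp: integral_distr)
  finally show ?thesis by simp
qed

lemma lborel_integrable_scale:
  fixes f :: "'a::euclidean_space \<Rightarrow> 'b::{banach, second_countable_topology}"
  assumes f: "integrable lborel f" and c: "c \<noteq> 0"
  shows "integrable lborel (\<lambda>x. f (c *\<^sub>R x))"
proof -
  have [measurable]: "f \<in> borel_measurable borel" using f by auto
  have "integrable (density (distr lborel borel (\<lambda>x. c *\<^sub>R x)) (\<lambda>_. ennreal (\<bar>c\<bar>^DIM('a)))) f"
    using f by (subst (asm) lborel_affine[OF c, of 0]) (simp add: ennreal_power)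
  then have "integrable lborel (\<lambda>x. \<bar>c\<bar>^DIM('a) *\<^sub>R f (c *\<^sub>R x))"
    by (subst (asm) integrable_density) (auto simp: integrable_distr_eq)
  from integrable_scaleR_right[OF this, of "1 / \<bar>c\<bar>^DIM('a)"]
  show ?thesis using c by simp
qed

text \<open>
  For an open set this is dominated convergence, since each point of an open set stays in the set under small
  translations. A general set is enclosed in an open one of almost the same measure: a point of \<open>A\<close> that leaves \<open>A\<close>
  leaves the open set or lands in the small difference, whose preimage has the same small measure.
\<close>

lemma measure_translation_loss_tendsto_0:
  fixes A :: "'a::euclidean_space set"
  assumes A [measurable]: "A \<in> sets borel" and fin: "emeasure lborel A < \<infinity>" and u: "u \<longlonglongrightarrow> 0"
  shows "(\<lambda>n. measure lborel {x\<in>A. x + u n \<notin> A}) \<longlonglongrightarrow> 0"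
proof (rule LIMSEQ_I)
  fix e :: real assume e: "0 < e"
  have "A \<in> sets lebesgue" by simp
  then obtain T where T: "open T" "A \<subseteq> T" and small: "emeasure lebesgue (T - A) < ennreal (e/2)"
    using sets_lebesgue_outer_open[of A "e/2"] e by auto
  have [measurable]: "T \<in> sets borel" using T by simp
  have small: "emeasure lborel (T - A) < ennreal (e/2)"
    using small by simp
  have shift: "emeasure lborel {x. x + u n \<in> T - A} = emeasure lborel (T - A)" for n
  proof -
    have "emeasure lborel (T - A) = emeasure (distr lborel borel (\<lambda>x. x + u n)) (T - A)"
      by (simp add: lborel_translate)
    also have "\<dots> = emeasure lborel {x. x + u n \<in> T - A}"
      by (subst emeasure_distr) (auto intro!: arg_cong2[where f=emeasure])
    finally show ?thesis by simp
  qed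
  have "(\<lambda>n. \<integral>x. indicator {x\<in>A. x + u n \<notin> T} x \<partial>lborel) \<longlonglongrightarrow> (\<integral>x. (0::real) \<partial>(lborel::'a measure))"
  proof (rule integral_dominated_convergence[where w = "indicator A"])
    show "AE x in lborel. (\<lambda>n. indicator {x \<in> A. x + u n \<notin> T} x :: real) \<longlonglongrightarrow> 0"
    proof (rule AE_I2)
      fix x
      show "(\<lambda>n. indicator {x \<in> A. x + u n \<notin> T} x :: real) \<longlonglongrightarrow> 0"
      proof (cases "x \<in> A")
        case True
        have "(\<lambda>n. x + u n) \<longlonglongrightarrow> x + 0" by (intro tendsto_intros u)
        then have "\<forall>\<^sub>F n in sequentially. x + u n \<in> T"
          using T True by (auto intro: topological_tendstoD)
        then have "\<forall>\<^sub>F n in sequentially. indicator {x \<in> A. x + u n \<notin> T} x = (0::real)"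
          by (auto elim: eventually_mono)
        then show ?thesis by (rule tendsto_eventually)
      qed simp
    qed
    show "integrable lborel (indicator A :: 'a \<Rightarrow> real)"
      using fin by simp
  qed (auto simp: indicator_def)
  then have "(\<lambda>n. measure lborel {x\<in>A. x + u n \<notin> T}) \<longlonglongrightarrow> 0" by simp
  then obtain n0 where n0: "\<And>n. n \<ge> n0 \<Longrightarrow> measure lborel {x\<in>A. x + u n \<notin> T} < e/2"
    using LIMSEQ_D[of _ 0 "e/2"] e by fastforce
  have "measure lborel {x\<in>A. x + u n \<notin> A} < e" if "n \<ge> n0" for n
  proof -
    have fm: "{x\<in>A. x + u n \<notin> T} \<in> fmeasurable lborel"
      by (rule fmeasurableI2[of A]) (auto intro: fmeasurableI fin)
    have fm2: "{x. x + u n \<in> T - A} \<in> fmeasurable lborel"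
      by (rule fmeasurableI) (use shift[of n] small in \<open>auto intro: less_trans\<close>)
    have "measure lborel {x\<in>A. x + u n \<notin> A} \<le> measure lborel ({x\<in>A. x + u n \<notin> T} \<union> {x. x + u n \<in> T - A})"
      using fm fm2 by (intro measure_mono_fmeasurable fmeasurable.Un) auto
    also have "\<dots> \<le> measure lborel {x\<in>A. x + u n \<notin> T} + measure lborel {x. x + u n \<in> T - A}"
      using fm fm2 by (intro measure_Un_le) auto
    also have "measure lborel {x. x + u n \<in> T - A} < e/2"
      using small unfolding measure_def shift[of n]
      by (cases "emeasure lborel (T - A)" rule: ennreal_cases) (auto simp: ennreal_less_iff)
    also have "measure lborel {x\<in>A. x + u n \<notin> T} < e/2" using n0 that by simp
    finally show ?thesis by simp
  qed
  then show "\<exists>n0. \<forall>n\<ge>n0. norm (measure lborel {x \<in> A. x + u n \<notin> A} - 0) < e" by auto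
qed

text \<open>
  Translation acts isometrically on \<open>L\<^sup>1\<close>, so continuity passes to sums and limits; for the indicator of a set \<open>A\<close>
  the distance is the measure lost by \<open>A\<close> under the translations by \<open>u\<close> and by \<open>-u\<close>.
\<close>

lemma L1_translation_continuous:
  fixes f :: "'a::euclidean_space \<Rightarrow> complex"
  assumes "integrable lborel f" and u: "u \<longlonglongrightarrow> 0"
  shows "(\<lambda>n. \<integral>x. cmod (f (x + u n) - f x) \<partial>lborel) \<longlonglongrightarrow> 0"
  using assms(1)
proof (induction rule: integrable_induct)
  case (base A c)
  then have A [measurable]: "A \<in> sets borel" and fin: "emeasure lborel A < \<infinity>" by auto
  have eq: "(\<integral>x. cmod (indicator A (x + u n) *\<^sub>R c - indicator A x *\<^sub>R c) \<partial>lborel)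
     = cmod c * (measure lborel {x\<in>A. x + u n \<notin> A} + measure lborel {x\<in>A. x + - u n \<notin> A})" for n
  proof -
    have fm: "{x\<in>A. x + u n \<notin> A} \<in> fmeasurable lborel"  "{x\<in>A. x + - u n \<notin> A} \<in> fmeasurable lborel"
      by (rule fmeasurableI2[of A]; auto intro: fmeasurableI fin)+
    have i: "integrable lborel (indicator {x\<in>A. x + u n \<notin> A} :: _ \<Rightarrow> real)"
      "integrable lborel (indicator {x\<in>A. x + - u n \<notin> A} :: _ \<Rightarrow> real)"
      using fm by (auto simp: fmeasurable_def)
    have i2: "integrable lborel (\<lambda>x. indicator {x\<in>A. x + - u n \<notin> A} (x + u n) :: real)"
      by (rule lborel_integrable_translate[OF i(2)])
    have "(\<integral>x. cmod (indicator A (x + u n) *\<^sub>R c - indicator A x *\<^sub>R c) \<partial>lborel)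
      = (\<integral>x. cmod c * (indicator {x\<in>A. x + u n \<notin> A} x + indicator {x\<in>A. x + - u n \<notin> A} (x + u n)) \<partial>lborel)"
      by (intro Bochner_Integration.integral_cong) (auto simp: indicator_def)
    also have "\<dots> = cmod c * ((\<integral>x. indicator {x\<in>A. x + u n \<notin> A} x \<partial>lborel) + (\<integral>x. indicator {x\<in>A. x + - u n \<notin> A} (x + u n) \<partial>lborel))"
      using i(1) i2 by (simp only: Bochner_Integration.integral_add integral_mult_right_zero)
    also have "(\<integral>x. indicator {x\<in>A. x + - u n \<notin> A} (x + u n) \<partial>lborel) = (\<integral>x. (indicator {x\<in>A. x + - u n \<notin> A} x :: real) \<partial>lborel)"
      by (rule lborel_integral_translate) measurable
    finally show ?thesis by simp
  qed
  have "(\<lambda>n. cmod c * (measure lborel {x\<in>A. x + u n \<notin> A} + measure lborel {x\<in>A. x + - u n \<notin> A})) \<longlonglongrightarrow> cmod c * (0 + 0)"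
    by (intro tendsto_mult tendsto_const tendsto_add measure_translation_loss_tendsto_0 A fin u)
       (use tendsto_minus[OF u] in simp)
  then show ?case unfolding eq by simp
next
  case (add f g)
  have if_: "integrable lborel (\<lambda>x. cmod (f (x + u n) - f x))" "integrable lborel (\<lambda>x. cmod (g (x + u n) - g x))" for n
    by (intro integrable_norm Bochner_Integration.integrable_diff lborel_integrable_translate add)+
  show ?case
  proof (rule tendsto_sandwich[where f = "\<lambda>_. 0"])
    show "(\<lambda>n. (\<integral>x. cmod (f (x + u n) - f x) \<partial>lborel) + (\<integral>x. cmod (g (x + u n) - g x) \<partial>lborel)) \<longlonglongrightarrow> 0"
      using tendsto_add[OF add(3,4)] add by simp
    show "\<forall>\<^sub>F n in sequentially. (\<integral>x. cmod (f (x + u n) + g (x + u n) - (f x + g x)) \<partial>lborel)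
       \<le> (\<integral>x. cmod (f (x + u n) - f x) \<partial>lborel) + (\<integral>x. cmod (g (x + u n) - g x) \<partial>lborel)"
    proof (rule always_eventually, rule allI)
      fix n
      have "(\<integral>x. cmod (f (x + u n) + g (x + u n) - (f x + g x)) \<partial>lborel) \<le> (\<integral>x. cmod (f (x + u n) - f x) + cmod (g (x + u n) - g x) \<partial>lborel)"
        using add if_[of n] by (intro integral_mono Bochner_Integration.integrable_add integrable_norm Bochner_Integration.integrable_diff lborel_integrable_translate norm_diff_triangle_ineq)
      then show "(\<integral>x. cmod (f (x + u n) + g (x + u n) - (f x + g x)) \<partial>lborel)
       \<le> (\<integral>x. cmod (f (x + u n) - f x) \<partial>lborel) + (\<integral>x. cmod (g (x + u n) - g x) \<partial>lborel)"
        using if_[of n] by simp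
    qed
  qed (auto intro!: always_eventually)
next
  case (lim f s)
  have f_meas [measurable]: "f \<in> borel_measurable borel" "\<And>i. s i \<in> borel_measurable borel" using lim by auto
  have s_le: "cmod (s i x) \<le> 2 * cmod (f x)" for i x using lim by simp
  have s_lim: "(\<lambda>i. s i x) \<longlonglongrightarrow> f x" for x using lim by simp
  have conv: "(\<lambda>i. \<integral>x. cmod (s i x - f x) \<partial>lborel) \<longlonglongrightarrow> (\<integral>x. 0 \<partial>(lborel::'a measure))"
  proof (rule integral_dominated_convergence[where w = "\<lambda>x. 3 * cmod (f x)"])
    show "AE x in lborel. (\<lambda>i. cmod (s i x - f x)) \<longlonglongrightarrow> 0"
      by (intro AE_I2 tendsto_norm_zero iffD2[OF LIM_zero_iff] s_lim)
    show "AE x in lborel. norm (cmod (s i x - f x)) \<le> 3 * cmod (f x)" for i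
    proof (rule AE_I2)
      fix x
      show "norm (cmod (s i x - f x)) \<le> 3 * cmod (f x)"
        using norm_triangle_ineq4[of "s i x" "f x"] s_le[of i x] by simp
    qed
  qed (use lim in auto)
  show ?case
  proof (rule LIMSEQ_I)
    fix e :: real assume "0 < e"
    then obtain i where i: "(\<integral>x. cmod (s i x - f x) \<partial>lborel) < e/3"
      using LIMSEQ_D[OF conv, of "e/3"] by fastforce
    obtain n0 where n0: "\<And>n. n \<ge> n0 \<Longrightarrow> (\<integral>x. cmod (s i (x + u n) - s i x) \<partial>lborel) < e/3"
      using LIMSEQ_D[OF lim.IH[of i], of "e/3"] \<open>0 < e\<close> by fastforce
    have "(\<integral>x. cmod (f (x + u n) - f x) \<partial>lborel) < e" if "n \<ge> n0" for n
    proof -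
      have I1: "integrable lborel (\<lambda>x. cmod (s i x - f x))" using lim by simp
      note I2 = lborel_integrable_translate[OF I1, of "u n"]
      have I3: "integrable lborel (\<lambda>x. cmod (s i (x + u n) - s i x))"
        by (intro integrable_norm Bochner_Integration.integrable_diff lborel_integrable_translate lim)
      have "(\<integral>x. cmod (f (x + u n) - f x) \<partial>lborel) \<le>
         (\<integral>x. cmod (s i (x + u n) - f (x + u n)) + (cmod (s i (x + u n) - s i x) + cmod (s i x - f x)) \<partial>lborel)"
      proof (rule integral_mono)
        show "integrable lborel (\<lambda>x. cmod (f (x + u n) - f x))"
          by (intro integrable_norm Bochner_Integration.integrable_diff lborel_integrable_translate lim)
        show "integrable lborel (\<lambda>x. cmod (s i (x + u n) - f (x + u n)) + (cmod (s i (x + u n) - s i x) + cmod (s i x - f x)))"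
          by (intro Bochner_Integration.integrable_add I1 I2 I3)
        fix x
        show "cmod (f (x + u n) - f x) \<le> cmod (s i (x + u n) - f (x + u n)) + (cmod (s i (x + u n) - s i x) + cmod (s i x - f x))"
          using norm_triangle_ineq[of "f (x + u n) - s i (x + u n)" "s i (x + u n) - f x"]
            norm_triangle_ineq[of "s i (x + u n) - s i x" "s i x - f x"]
          by (simp add: norm_minus_commute[of "f (x + u n)"])
      qed
      also have "\<dots> = (\<integral>x. cmod (s i (x + u n) - f (x + u n)) \<partial>lborel) + ((\<integral>x. cmod (s i (x + u n) - s i x) \<partial>lborel) + (\<integral>x. cmod (s i x - f x) \<partial>lborel))"
        using I1 I2 I3 by (simp only: Bochner_Integration.integral_add Bochner_Integration.integrable_add)
      also have "(\<integral>x. cmod (s i (x + u n) - f (x + u n)) \<partial>lborel) = (\<integral>x. cmod (s i x - f x) \<partial>lborel)"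
        by (rule lborel_integral_translate) measurable
      finally show ?thesis using i n0[OF that] by simp
    qed
    then show "\<exists>n0. \<forall>n\<ge>n0. norm ((\<integral>x. cmod (f (x + u n) - f x) \<partial>lborel) - 0) < e" by auto
  qed
qed

section \<open>The Fourier transform and the Gaussian\<close>

definition fourier :: "('a::euclidean_space \<Rightarrow> complex) \<Rightarrow> 'a \<Rightarrow> complex" where
  "fourier f \<xi> = (\<integral>x. f x * cis (2 * pi * (x \<bullet> \<xi>)) \<partial>lborel)"

text \<open>
  The exponent is normalised so that this Gaussian has integral 1 and is its own Fourier transform.
\<close>

definition gauss :: "'a::euclidean_space \<Rightarrow> real" where
  "gauss x = exp (- pi * (x \<bullet> x))"

lemma gauss_nonneg [simp]: "0 \<le> gauss x"
  by (simp add: gauss_def)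

lemma gauss_measurable [measurable]: "gauss \<in> borel_measurable borel"
  unfolding gauss_def by measurable

lemma borel_measurable_cis [measurable (raw)]:
  "f \<in> borel_measurable M \<Longrightarrow> (\<lambda>x. cis (f x)) \<in> borel_measurable M"
  by (rule borel_measurable_continuous_on[of cis]) (auto intro!: continuous_intros)

text \<open>
  The characteristic function of the standard normal distribution, rescaled by \<open>\<surd>(2 \<pi>)\<close>.
\<close>

lemma
  shows gauss_real_integrable: "integrable lborel (gauss :: real \<Rightarrow> real)"
    and fourier_gauss_real: "fourier (\<lambda>x::real. complex_of_real (gauss x)) \<xi> = complex_of_real (gauss \<xi>)"
proof -
  define s where "s = sqrt (2 * pi)"
  have s: "s > 0" "s * s = 2 * pi" unfolding s_def by auto
  have g: "gauss (x::real) = s * std_normal_density (s * x)" for x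
  proof -
    have "(s * x)\<^sup>2 = (s * s) * (x * x)" by (simp add: power2_eq_square)
    then have "(s * x)\<^sup>2 / 2 = pi * (x * x)" by (simp add: s(2))
    then show ?thesis using s(1) by (simp add: gauss_def std_normal_density_def flip: s_def)
  qed
  have "integrable lborel std_normal_density"
    using integrable_normal_density[of 1 0] by simp
  from lborel_integrable_real_affine[OF this, of s 0] s
  show "integrable lborel (gauss :: real \<Rightarrow> real)"
    unfolding g[abs_def] by simp
  have "complex_of_real (gauss \<xi>) = char std_normal_distribution (s * \<xi>)"
  proof -
    have "(s * \<xi>)\<^sup>2 = (s * s) * (\<xi> * \<xi>)" by (simp add: power2_eq_square)
    then have "(s * \<xi>)\<^sup>2 / 2 = pi * (\<xi> * \<xi>)" by (simp add: s(2))
    then show ?thesis by (simp add: char_std_normal_distribution gauss_def)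
  qed
  also have "\<dots> = (\<integral>x. std_normal_density x *\<^sub>R iexp (s * \<xi> * x) \<partial>lborel)"
    unfolding char_def by (subst integral_density) (auto simp: normal_density_nonneg)
  also have "\<dots> = s *\<^sub>R (\<integral>x. std_normal_density (s * x) *\<^sub>R iexp (s * \<xi> * (s * x)) \<partial>lborel)"
    using lborel_integral_real_affine[of s "\<lambda>x. std_normal_density x *\<^sub>R iexp (s * \<xi> * x)" 0] s by simp
  also have "\<dots> = (\<integral>x. (s * std_normal_density (s * x)) *\<^sub>R iexp (s * \<xi> * (s * x)) \<partial>lborel)"
    by (simp only: scaleR_scaleR[symmetric] integral_scaleR_right)
  also have "\<dots> = fourier (\<lambda>x::real. complex_of_real (gauss x)) \<xi>"
    unfolding fourier_def g
  proof (intro Bochner_Integration.integral_cong refl)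
    fix x :: real
    have "s * \<xi> * (s * x) = (s * s) * (x * \<xi>)" by simp
    then have "iexp (s * \<xi> * (s * x)) = cis (2 * pi * (x \<bullet> \<xi>))"
      by (simp only: s(2) cis_conv_exp inner_real_def)
    then show "(s * std_normal_density (s * x)) *\<^sub>R iexp (s * \<xi> * (s * x)) = complex_of_real (s * std_normal_density (s * x)) * cis (2 * pi * (x \<bullet> \<xi>))"
      by (simp only: scaleR_conv_of_real)
  qed
  finally show "fourier (\<lambda>x::real. complex_of_real (gauss x)) \<xi> = complex_of_real (gauss \<xi>)" by simp
qed

interpretation lborel_product: product_sigma_finite "\<lambda>_. lborel :: real measure" ..

lemma
  fixes f :: "'a::euclidean_space \<Rightarrow> real \<Rightarrow> complex"
  assumes int: "\<And>b. b \<in> Basis \<Longrightarrow> integrable lborel (f b)"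
  shows integrable_lborel_prod: "integrable lborel (\<lambda>x. \<Prod>b\<in>Basis. f b (x \<bullet> b))"
    and integral_lborel_prod: "(\<integral>x. (\<Prod>b\<in>Basis. f b (x \<bullet> b)) \<partial>lborel) = (\<Prod>b\<in>Basis. \<integral>x. f b x \<partial>lborel)"
proof -
  have [measurable]: "f b \<in> borel_measurable borel" if "b \<in> Basis" for b using int[OF that] by auto
  have eq: "(\<Prod>b\<in>Basis. f b ((\<Sum>c\<in>Basis. g c *\<^sub>R c) \<bullet> b)) = (\<Prod>b\<in>Basis. f b (g b))" for g :: "'a \<Rightarrow> real"
    by (intro prod.cong refl) simp
  show "integrable lborel (\<lambda>x. \<Prod>b\<in>Basis. f b (x \<bullet> b))"
    unfolding lborel_eq[where 'a='a]
    by (subst integrable_distr_eq) (auto simp: eq intro!: lborel_product.product_integrable_prod int)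
  show "(\<integral>x. (\<Prod>b\<in>Basis. f b (x \<bullet> b)) \<partial>lborel) = (\<Prod>b\<in>Basis. \<integral>x. f b x \<partial>lborel)"
    unfolding lborel_eq[where 'a='a]
    by (subst integral_distr) (auto simp: eq intro!: lborel_product.product_integral_prod int)
qed

lemma gauss_prod: "gauss (x::'a::euclidean_space) = (\<Prod>b\<in>Basis. gauss (x \<bullet> b))"
  unfolding gauss_def by (subst euclidean_inner) (simp add: sum_distrib_left exp_sum flip: sum_negf)

lemma cis_sum: "finite A \<Longrightarrow> cis (\<Sum>a\<in>A. f a) = (\<Prod>a\<in>A. cis (f a))"
  by (induction A rule: finite_induct) (auto simp: cis_mult[symmetric])

lemma
  shows gauss_integrable: "integrable lborel (gauss :: 'a::euclidean_space \<Rightarrow> real)"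
    and fourier_gauss: "fourier (\<lambda>x::'a. complex_of_real (gauss x)) \<xi> = complex_of_real (gauss \<xi>)"
proof -
  have i: "integrable lborel (\<lambda>x. complex_of_real (gauss (x::real)))"
    using gauss_real_integrable by simp
  have i2: "integrable lborel (\<lambda>x. complex_of_real (gauss (x::real)) * cis (2 * pi * (x * t)))" for t
    by (rule Bochner_Integration.integrable_bound[OF i]) (auto simp: norm_mult)
  have "integrable lborel (\<lambda>x::'a. \<Prod>b\<in>Basis. complex_of_real (gauss (x \<bullet> b)))"
    by (rule integrable_lborel_prod) (rule i)
  then have "integrable lborel (\<lambda>x::'a. complex_of_real (gauss x))"
    by (simp add: gauss_prod[where 'a='a])
  then show "integrable lborel (gauss :: 'a::euclidean_space \<Rightarrow> real)"
    by (simp add: complex_of_real_integrable_eq)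
  have "fourier (\<lambda>x::'a. complex_of_real (gauss x)) \<xi> = (\<integral>x. (\<Prod>b\<in>Basis. complex_of_real (gauss (x \<bullet> b)) * cis (2 * pi * ((x \<bullet> b) * (\<xi> \<bullet> b)))) \<partial>lborel)"
    unfolding fourier_def
    by (subst euclidean_inner) (simp add: gauss_prod[where 'a='a] prod.distrib sum_distrib_left cis_sum)
  also have "\<dots> = (\<Prod>b\<in>Basis. \<integral>x. complex_of_real (gauss x) * cis (2 * pi * (x * (\<xi> \<bullet> b))) \<partial>lborel)"
    by (rule integral_lborel_prod[of "\<lambda>b x. complex_of_real (gauss x) * cis (2 * pi * (x * (\<xi> \<bullet> b)))"]) (rule i2)
  also have "\<dots> = (\<Prod>b\<in>Basis. complex_of_real (gauss (\<xi> \<bullet> b)))"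
    using fourier_gauss_real by (simp add: fourier_def)
  also have "\<dots> = complex_of_real (gauss \<xi>)"
    by (simp add: gauss_prod[where 'a='a])
  finally show "fourier (\<lambda>x::'a. complex_of_real (gauss x)) \<xi> = complex_of_real (gauss \<xi>)" .
qed

lemma integral_gauss: "(\<integral>x. gauss (x::'a::euclidean_space) \<partial>lborel) = 1"
proof -
  have "complex_of_real (\<integral>x. gauss (x::'a) \<partial>lborel) = fourier (\<lambda>x::'a. complex_of_real (gauss x)) 0"
    by (simp add: fourier_def)
  also have "\<dots> = 1" unfolding fourier_gauss by (simp add: gauss_def)
  finally show ?thesis by (simp only: of_real_eq_1_iff)
qed

lemma fourier_measurable [measurable]:
  assumes [measurable]: "f \<in> borel_measurable borel"
  shows "fourier f \<in> borel_measurable (borel :: 'a::euclidean_space measure)"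
  unfolding fourier_def[abs_def] by measurable

lemma fourier_bound: "cmod (fourier f \<xi>) \<le> (\<integral>x. cmod (f x) \<partial>lborel)"
  unfolding fourier_def by (rule order_trans[OF integral_norm_bound]) (simp add: norm_mult)

lemma fourier_integrand_integrable:
  assumes f: "integrable lborel f"
  shows "integrable lborel (\<lambda>x::'a::euclidean_space. f x * cis (2 * pi * (x \<bullet> \<xi>)))"
proof -
  have [measurable]: "f \<in> borel_measurable borel" using f by auto
  show ?thesis
    by (rule Bochner_Integration.integrable_bound[OF f]) (auto simp: norm_mult)
qed

text \<open>
  Both sides are the double integral of \<open>f x * cis (2 * pi * (x \<bullet> \<xi>)) * g \<xi>\<close>.
\<close>

lemma fourier_exchange:
  fixes f g :: "'a::euclidean_space \<Rightarrow> complex"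
  assumes f: "integrable lborel f" and g: "integrable lborel g"
  shows "(\<integral>\<xi>. fourier f \<xi> * g \<xi> \<partial>lborel) = (\<integral>x. f x * fourier g x \<partial>lborel)"
proof -
  have [measurable]: "f \<in> borel_measurable borel" "g \<in> borel_measurable borel" using f g by auto
  have int: "integrable (lborel \<Otimes>\<^sub>M lborel) (\<lambda>(x, \<xi>). f x * cis (2 * pi * (x \<bullet> \<xi>)) * g \<xi>)"
  proof (rule lborel_pair.Fubini_integrable)
    show "integrable lborel (\<lambda>x. \<integral>\<xi>. cmod (case (x, \<xi>) of (x, \<xi>) \<Rightarrow> f x * cis (2 * pi * (x \<bullet> \<xi>)) * g \<xi>) \<partial>lborel)"
      using f g by (simp add: norm_mult)
    show "AE x in lborel. integrable lborel (\<lambda>\<xi>. case (x, \<xi>) of (x, \<xi>) \<Rightarrow> f x * cis (2 * pi * (x \<bullet> \<xi>)) * g \<xi>)"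
      using fourier_integrand_integrable[OF g]
      by (intro AE_I2) (simp add: mult.assoc mult.commute[of "cis _"] inner_commute)
  qed measurable
  have "(\<integral>\<xi>. fourier f \<xi> * g \<xi> \<partial>lborel) = (\<integral>\<xi>. (\<integral>x. f x * cis (2 * pi * (x \<bullet> \<xi>)) * g \<xi> \<partial>lborel) \<partial>lborel)"
    by (simp add: fourier_def)
  also have "\<dots> = (\<integral>x. (\<integral>\<xi>. f x * cis (2 * pi * (x \<bullet> \<xi>)) * g \<xi> \<partial>lborel) \<partial>lborel)"
    using lborel_pair.Fubini_integral[OF int] by simp
  also have "\<dots> = (\<integral>x. f x * fourier g x \<partial>lborel)"
    by (simp add: fourier_def mult.assoc mult.commute[of "cis _"] inner_commute)
  finally show ?thesis .
qed

section \<open>Autocorrelation and the Plancherel theorem\<close>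

text \<open>
  The convolution of \<open>f\<close> with its reflected conjugate. Its Fourier transform is \<open>|fourier f|\<^sup>2\<close>, and its value
  at \<open>0\<close> is the squared norm of \<open>f\<close>; the Plancherel theorem is Fourier inversion for this function at \<open>0\<close>.
\<close>

definition autocorrelation :: "('a::euclidean_space \<Rightarrow> complex) \<Rightarrow> 'a \<Rightarrow> complex" where
  "autocorrelation f u = (\<integral>y. f (y + u) * cnj (f y) \<partial>lborel)"

lemma autocorrelation_measurable [measurable]:
  assumes [measurable]: "f \<in> borel_measurable borel"
  shows "autocorrelation f \<in> borel_measurable (borel :: 'a::euclidean_space measure)"
  unfolding autocorrelation_def[abs_def] by measurable

lemma
  fixes f :: "'a::euclidean_space \<Rightarrow> complex"
  assumes f: "integrable lborel f"
  shows autocorrelation_integrable: "integrable lborel (autocorrelation f)"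
    and fourier_autocorrelation: "fourier (autocorrelation f) \<xi> = complex_of_real ((cmod (fourier f \<xi>))\<^sup>2)"
proof -
  have [measurable]: "f \<in> borel_measurable borel" using f by auto
  have int: "integrable (lborel \<Otimes>\<^sub>M lborel) (\<lambda>(y, u). f (y + u) * cnj (f y) * cis (2 * pi * (u \<bullet> \<xi>)))" for \<xi>
  proof (rule lborel_pair.Fubini_integrable)
    have "(\<integral>u. cmod (f (y + u)) \<partial>lborel) = (\<integral>u. cmod (f u) \<partial>lborel)" for y
      using lborel_integral_translate[of "\<lambda>u. cmod (f u)" y] by (simp add: add.commute)
    then show "integrable lborel (\<lambda>y. \<integral>u. cmod (case (y, u) of (y, u) \<Rightarrow> f (y + u) * cnj (f y) * cis (2 * pi * (u \<bullet> \<xi>))) \<partial>lborel)"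
      using f by (simp add: norm_mult)
    show "AE y in lborel. integrable lborel (\<lambda>u. case (y, u) of (y, u) \<Rightarrow> f (y + u) * cnj (f y) * cis (2 * pi * (u \<bullet> \<xi>)))"
    proof (rule AE_I2)
      fix y
      have "integrable lborel (\<lambda>u. cnj (f y) * f (y + u))"
        using lborel_integrable_translate[OF f, of y] by (simp add: add.commute)
      from fourier_integrand_integrable[OF this, of \<xi>]
      show "integrable lborel (\<lambda>u. case (y, u) of (y, u) \<Rightarrow> f (y + u) * cnj (f y) * cis (2 * pi * (u \<bullet> \<xi>)))"
        by (simp add: mult.commute)
    qed
  qed measurable
  show "integrable lborel (autocorrelation f)"
    using lborel_pair.integrable_fst'[OF lborel_pair.integrable_product_swap[OF int[of 0]]]
    by (simp add: autocorrelation_def[abs_def])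
  have "fourier (autocorrelation f) \<xi> = (\<integral>u. (\<integral>y. f (y + u) * cnj (f y) * cis (2 * pi * (u \<bullet> \<xi>)) \<partial>lborel) \<partial>lborel)"
    by (simp add: fourier_def autocorrelation_def)
  also have "\<dots> = (\<integral>y. (\<integral>u. f (y + u) * cnj (f y) * cis (2 * pi * (u \<bullet> \<xi>)) \<partial>lborel) \<partial>lborel)"
    using lborel_pair.Fubini_integral[OF int] by simp
  also have "\<dots> = (\<integral>y. fourier f \<xi> * cnj (f y * cis (2 * pi * (y \<bullet> \<xi>))) \<partial>lborel)"
  proof (intro Bochner_Integration.integral_cong refl)
    fix y
    have "(\<integral>u. f (y + u) * cnj (f y) * cis (2 * pi * (u \<bullet> \<xi>)) \<partial>lborel)
       = (\<integral>u. f (u + y) * cis (2 * pi * ((u + y) \<bullet> \<xi>)) * cnj (f y * cis (2 * pi * (y \<bullet> \<xi>))) \<partial>lborel)"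
    proof (intro Bochner_Integration.integral_cong refl)
      fix u
      have e: "cis (2 * pi * ((u + y) \<bullet> \<xi>)) = cis (2 * pi * (u \<bullet> \<xi>)) * cis (2 * pi * (y \<bullet> \<xi>))"
        by (simp add: cis_mult inner_add_left distrib_left)
      have "cis t * cnj (cis t) = 1" for t by (simp add: cis_cnj cis_mult)
      then have "f (y + u) * cnj (f y) * cis (2 * pi * (u \<bullet> \<xi>)) = f (y + u) * cnj (f y) * cis (2 * pi * (u \<bullet> \<xi>)) * (cis (2 * pi * (y \<bullet> \<xi>)) * cnj (cis (2 * pi * (y \<bullet> \<xi>))))"
        by simp
      then show "f (y + u) * cnj (f y) * cis (2 * pi * (u \<bullet> \<xi>)) = f (u + y) * cis (2 * pi * ((u + y) \<bullet> \<xi>)) * cnj (f y * cis (2 * pi * (y \<bullet> \<xi>)))"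
        unfolding e complex_cnj_mult by (simp only: ac_simps)
    qed
    also have "\<dots> = (\<integral>u. f u * cis (2 * pi * (u \<bullet> \<xi>)) * cnj (f y * cis (2 * pi * (y \<bullet> \<xi>))) \<partial>lborel)"
      by (rule lborel_integral_translate) measurable
    also have "\<dots> = fourier f \<xi> * cnj (f y * cis (2 * pi * (y \<bullet> \<xi>)))"
      unfolding fourier_def by simp
    finally show "(\<integral>u. f (y + u) * cnj (f y) * cis (2 * pi * (u \<bullet> \<xi>)) \<partial>lborel) = fourier f \<xi> * cnj (f y * cis (2 * pi * (y \<bullet> \<xi>)))" .
  qed
  also have "\<dots> = fourier f \<xi> * (\<integral>y. cnj (f y * cis (2 * pi * (y \<bullet> \<xi>))) \<partial>lborel)"
    by simp
  also have "(\<integral>y. cnj (f y * cis (2 * pi * (y \<bullet> \<xi>))) \<partial>lborel) = cnj (fourier f \<xi>)"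
    unfolding fourier_def by (rule Bochner_Integration.integral_cnj)
  finally show "fourier (autocorrelation f) \<xi> = complex_of_real ((cmod (fourier f \<xi>))\<^sup>2)"
    by (simp add: complex_norm_square del: of_real_power)
qed

lemma autocorrelation_bound:
  assumes f: "f \<in> L2_space lborel"
  shows "cmod (autocorrelation f u) \<le> (norm_L2 lborel f)\<^sup>2"
proof -
  have "cmod (autocorrelation f u) \<le> (\<integral>y. cmod (f (y + u)) * cmod (f y) \<partial>lborel)"
    unfolding autocorrelation_def by (rule order_trans[OF integral_norm_bound]) (simp add: norm_mult)
  also have "\<dots> \<le> norm_L2 lborel (\<lambda>y. f (y + u)) * norm_L2 lborel f"
    by (intro L2_Cauchy_Schwarz L2_translate f)
  also have "\<dots> = (norm_L2 lborel f)\<^sup>2"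
    using L2_spaceD[OF f] by (simp add: norm_L2_translate power2_eq_square)
  finally show ?thesis .
qed

text \<open>
  Where \<open>|f|\<close> is at most \<open>M\<close>, the increment is controlled by \<open>M\<close> times the \<open>L\<^sup>1\<close> distance between \<open>f\<close> and its
  translate. The contribution of the large values of \<open>f\<close> is small uniformly in the translation, by the
  Cauchy--Schwarz inequality.
\<close>

lemma autocorrelation_continuous_0:
  fixes f :: "'a::euclidean_space \<Rightarrow> complex"
  assumes f1: "integrable lborel f" and f2: "f \<in> L2_space lborel" and u: "u \<longlonglongrightarrow> 0"
  shows "(\<lambda>n. autocorrelation f (u n)) \<longlonglongrightarrow> autocorrelation f 0"
proof -
  have [measurable]: "f \<in> borel_measurable borel" using f1 by auto
  \<comment> \<open>the part of \<open>f\<close> where it is larger than \<open>M\<close>\<close>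
  define h where "h M x = (if cmod (f x) \<le> real M then 0 else f x)" for M x
  have hm [measurable]: "h M \<in> borel_measurable borel" for M unfolding h_def by measurable
  have hle: "cmod (h M x) \<le> cmod (f x)" for M x by (simp add: h_def)
  have h2: "h M \<in> L2_space lborel" for M
  proof -
    have "energy lborel (h M) \<le> energy lborel f"
      unfolding energy_def by (intro nn_integral_mono ennreal_leI power_mono hle) auto
    then show ?thesis using f2 by (auto simp: L2_space_iff_energy)
  qed
  have "(\<lambda>M. \<integral>x. (cmod (h M x))\<^sup>2 \<partial>lborel) \<longlonglongrightarrow> (\<integral>x. 0 \<partial>(lborel::'a measure))"
  proof (rule integral_dominated_convergence[where w = "\<lambda>x. (cmod (f x))\<^sup>2"])
    show "AE x in lborel. (\<lambda>M. (cmod (h M x))\<^sup>2) \<longlonglongrightarrow> 0"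
    proof (rule AE_I2)
      fix x
      have "\<forall>\<^sub>F M in sequentially. cmod (f x) \<le> real M"
        by (rule eventually_sequentiallyI[of "nat \<lceil>cmod (f x)\<rceil>"]) linarith
      then have "\<forall>\<^sub>F M in sequentially. (cmod (h M x))\<^sup>2 = 0"
        by eventually_elim (simp add: h_def)
      then show "(\<lambda>M. (cmod (h M x))\<^sup>2) \<longlonglongrightarrow> 0" by (rule tendsto_eventually)
    qed
    show "integrable lborel (\<lambda>x. (cmod (f x))\<^sup>2)" using f2 by (simp add: L2_space_def)
    show "AE x in lborel. norm ((cmod (h M x))\<^sup>2) \<le> (cmod (f x))\<^sup>2" for M
      by (rule AE_I2) (simp add: power_mono hle)
  qed auto
  then have "(\<lambda>M. sqrt (\<integral>x. (cmod (h M x))\<^sup>2 \<partial>lborel)) \<longlonglongrightarrow> sqrt 0"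
    by (intro tendsto_real_sqrt) simp
  then have h0: "(\<lambda>M. norm_L2 lborel (h M)) \<longlonglongrightarrow> 0" by (simp add: norm_L2_def)
  let ?D = "\<lambda>n. \<integral>x. cmod (f (x + u n) - f x) \<partial>lborel"
  have est: "cmod (autocorrelation f (u n) - autocorrelation f 0) \<le> real M * ?D n + 2 * norm_L2 lborel f * norm_L2 lborel (h M)" for n M
  proof -
    have I: "integrable lborel (\<lambda>x. cmod (f (x + u n) - f x))"
      by (intro integrable_norm Bochner_Integration.integrable_diff lborel_integrable_translate f1)
    have L: "(\<lambda>x. f (x + u n) - f x) \<in> L2_space lborel"
      by (intro L2_diff L2_translate f2)
    have J: "integrable lborel (\<lambda>x. cmod (f (x + u n) - f x) * cmod (h M x))"
      using integrable_norm[OF L2_product_integrable[OF L h2[of M]]] by (simp add: norm_mult)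
    have p: "integrable lborel (\<lambda>y. f (y + v) * cnj (f y))" for v
      by (intro L2_product_integrable L2_translate f2)
    have "autocorrelation f (u n) - autocorrelation f 0 = (\<integral>y. f (y + u n) * cnj (f y) - f y * cnj (f y) \<partial>lborel)"
      unfolding autocorrelation_def using p[of 0] p by (subst Bochner_Integration.integral_diff) auto
    also have "cmod \<dots> \<le> (\<integral>y. cmod (f (y + u n) * cnj (f y) - f y * cnj (f y)) \<partial>lborel)"
      by (rule integral_norm_bound)
    also have "\<dots> \<le> (\<integral>y. real M * cmod (f (y + u n) - f y) + cmod (f (y + u n) - f y) * cmod (h M y) \<partial>lborel)"
    proof (rule integral_mono)
      show "integrable lborel (\<lambda>y. cmod (f (y + u n) * cnj (f y) - f y * cnj (f y)))"
        using p[of 0] p by (intro integrable_norm Bochner_Integration.integrable_diff) auto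
      show "integrable lborel (\<lambda>y. real M * cmod (f (y + u n) - f y) + cmod (f (y + u n) - f y) * cmod (h M y))"
        using I J by simp
      fix y
      have "cmod (f (y + u n) * cnj (f y) - f y * cnj (f y)) = cmod (f (y + u n) - f y) * cmod (f y)"
        by (simp add: norm_mult flip: left_diff_distrib)
      also have "\<dots> \<le> cmod (f (y + u n) - f y) * (real M + cmod (h M y))"
        by (intro mult_left_mono) (auto simp: h_def)
      finally show "cmod (f (y + u n) * cnj (f y) - f y * cnj (f y)) \<le> real M * cmod (f (y + u n) - f y) + cmod (f (y + u n) - f y) * cmod (h M y)"
        by (simp add: algebra_simps)
    qed
    also have "\<dots> = real M * ?D n + (\<integral>y. cmod (f (y + u n) - f y) * cmod (h M y) \<partial>lborel)"
      using I J by simp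
    also have "(\<integral>y. cmod (f (y + u n) - f y) * cmod (h M y) \<partial>lborel) \<le> norm_L2 lborel (\<lambda>x. f (x + u n) - f x) * norm_L2 lborel (h M)"
      by (rule L2_Cauchy_Schwarz[OF L h2])
    also have "\<dots> \<le> (2 * norm_L2 lborel f) * norm_L2 lborel (h M)"
    proof (rule mult_right_mono)
      have "norm_L2 lborel (\<lambda>x. f (x + u n) - f x) \<le> norm_L2 lborel (\<lambda>x. f (x + u n) - 0) + norm_L2 lborel (\<lambda>x. 0 - f x)"
        by (rule norm_L2_triangle_diff) (auto intro: L2_translate f2)
      also have "\<dots> = 2 * norm_L2 lborel f"
        using norm_L2_translate[of f "u n"] norm_L2_minus_commute[of lborel "\<lambda>_. 0" f] by simp
      finally show "norm_L2 lborel (\<lambda>x. f (x + u n) - f x) \<le> 2 * norm_L2 lborel f" .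
    qed simp
    finally show ?thesis by simp
  qed
  show ?thesis
  proof (rule LIMSEQ_I)
    fix e :: real assume e: "0 < e"
    have "(\<lambda>M. 2 * norm_L2 lborel f * norm_L2 lborel (h M)) \<longlonglongrightarrow> 2 * norm_L2 lborel f * 0"
      by (intro tendsto_intros h0)
    then obtain M where M: "2 * norm_L2 lborel f * norm_L2 lborel (h M) < e/2"
      using LIMSEQ_D[of "\<lambda>M. 2 * norm_L2 lborel f * norm_L2 lborel (h M)" 0 "e/2"] e by (auto simp: abs_mult)
    have "(\<lambda>n. real M * ?D n) \<longlonglongrightarrow> real M * 0"
      by (intro tendsto_intros L1_translation_continuous f1 u)
    then obtain n0 where n0: "\<And>n. n \<ge> n0 \<Longrightarrow> \<bar>real M * ?D n\<bar> < e/2"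
      using LIMSEQ_D[of "\<lambda>n. real M * ?D n" 0 "e/2"] e by auto
    have "cmod (autocorrelation f (u n) - autocorrelation f 0) < e" if "n \<ge> n0" for n
      using est[of n M] M n0[OF that] by simp
    then show "\<exists>n0. \<forall>n\<ge>n0. cmod (autocorrelation f (u n) - autocorrelation f 0) < e" by blast
  qed
qed

lemma fourier_scale:
  fixes f :: "'a::euclidean_space \<Rightarrow> complex"
  assumes [measurable]: "f \<in> borel_measurable borel" and c: "c > 0"
  shows "fourier f (inverse c *\<^sub>R \<xi>) = c^DIM('a) *\<^sub>R fourier (\<lambda>x. f (c *\<^sub>R x)) \<xi>"
proof -
  have e: "(c *\<^sub>R x) \<bullet> (inverse c *\<^sub>R \<xi>) = x \<bullet> \<xi>" for x using c by simp
  show ?thesis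
    unfolding fourier_def using c
    by (subst lborel_integral_scale[where c = c]) (simp_all only: e, simp_all)
qed

text \<open>
  Damp \<open>|fourier f|\<^sup>2 = fourier A\<close>, where \<open>A\<close> is the autocorrelation, by the Gaussian \<open>gauss (c *\<^sub>R \<xi>)\<close>. Moving the Fourier
  transform to the Gaussian turns the damped integral into the average of \<open>A (c *\<^sub>R v)\<close> with weight \<open>gauss v\<close>. As \<open>c\<close>
  tends to \<open>0\<close>, the damped integral increases to the energy of \<open>fourier f\<close>, while the average tends to \<open>A 0\<close>,
  because \<open>A\<close> is bounded and continuous at \<open>0\<close>.
\<close>

theorem Plancherel:
  fixes f :: "'a::euclidean_space \<Rightarrow> complex"
  assumes f1: "integrable lborel f" and f2: "f \<in> L2_space lborel"
  shows "energy lborel (fourier f) = energy lborel f"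
proof -
  have [measurable]: "f \<in> borel_measurable borel" using f1 by auto
  let ?A = "autocorrelation f"
  define c where "c k = inverse (real (Suc k))" for k
  have c: "c k > 0" for k by (simp add: c_def)
  have c0: "c \<longlonglongrightarrow> 0" unfolding c_def by (rule LIMSEQ_inverse_real_of_nat)
  have weight: "(\<integral>\<xi>. (cmod (fourier f \<xi>))\<^sup>2 * gauss (c k *\<^sub>R \<xi>) \<partial>lborel) = Re (\<integral>v. ?A (c k *\<^sub>R v) * complex_of_real (gauss v) \<partial>lborel)" for k
  proof -
    have "complex_of_real (\<integral>\<xi>. (cmod (fourier f \<xi>))\<^sup>2 * gauss (c k *\<^sub>R \<xi>) \<partial>lborel)
       = (\<integral>\<xi>. fourier ?A \<xi> * complex_of_real (gauss (c k *\<^sub>R \<xi>)) \<partial>lborel)"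
      by (subst integral_complex_of_real[symmetric]) (simp add: fourier_autocorrelation[OF f1])
    also have "\<dots> = \<bar>inverse (c k)\<bar>^DIM('a) *\<^sub>R (\<integral>\<xi>. fourier ?A (inverse (c k) *\<^sub>R \<xi>) * complex_of_real (gauss \<xi>) \<partial>lborel)"
      using c[of k] by (subst lborel_integral_scale[where c = "inverse (c k)"]) auto
    also have "\<dots> = (\<integral>\<xi>. fourier (\<lambda>x. ?A (c k *\<^sub>R x)) \<xi> * complex_of_real (gauss \<xi>) \<partial>lborel)"
      using c[of k] by (simp add: fourier_scale power_inverse)
    also have "\<dots> = (\<integral>v. ?A (c k *\<^sub>R v) * fourier (\<lambda>x. complex_of_real (gauss x)) v \<partial>lborel)"
      using c[of k] gauss_integrable
      by (intro fourier_exchange lborel_integrable_scale autocorrelation_integrable f1) auto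
    finally show ?thesis
      by (simp only: fourier_gauss) (metis Re_complex_of_real)
  qed
  have "(\<lambda>k. \<integral>v. ?A (c k *\<^sub>R v) * complex_of_real (gauss v) \<partial>lborel) \<longlonglongrightarrow> (\<integral>v. ?A 0 * complex_of_real (gauss (v::'a)) \<partial>lborel)"
  proof (rule integral_dominated_convergence[where w = "\<lambda>v. (norm_L2 lborel f)\<^sup>2 * gauss v"])
    show "AE v in lborel. (\<lambda>k. ?A (c k *\<^sub>R v) * complex_of_real (gauss v)) \<longlonglongrightarrow> ?A 0 * complex_of_real (gauss v)"
    proof (rule AE_I2)
      fix v :: 'a
      have "(\<lambda>k. c k *\<^sub>R v) \<longlonglongrightarrow> 0 *\<^sub>R v" by (intro tendsto_intros c0)
      then show "(\<lambda>k. ?A (c k *\<^sub>R v) * complex_of_real (gauss v)) \<longlonglongrightarrow> ?A 0 * complex_of_real (gauss v)"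
        by (intro tendsto_intros autocorrelation_continuous_0 f1 f2) simp
    qed
    show "AE v in lborel. norm (?A (c k *\<^sub>R v) * complex_of_real (gauss v)) \<le> (norm_L2 lborel f)\<^sup>2 * gauss v" for k
      by (rule AE_I2) (simp add: norm_mult mult_right_mono autocorrelation_bound[OF f2])
  qed (use gauss_integrable in auto)
  then have "(\<lambda>k. Re (\<integral>v. ?A (c k *\<^sub>R v) * complex_of_real (gauss v) \<partial>lborel)) \<longlonglongrightarrow> Re (?A 0)"
    by (intro tendsto_Re) (simp add: integral_complex_of_real integral_gauss)
  also have "Re (?A 0) = (norm_L2 lborel f)\<^sup>2"
  proof -
    have "?A 0 = (\<integral>y. complex_of_real ((cmod (f y))\<^sup>2) \<partial>lborel)"
      unfolding autocorrelation_def by (simp add: complex_norm_square del: of_real_power)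
    then have "Re (?A 0) = (\<integral>y. (cmod (f y))\<^sup>2 \<partial>lborel)"
      by (metis Re_complex_of_real integral_complex_of_real)
    then show ?thesis by (simp add: norm_L2_def)
  qed
  finally have lim: "(\<lambda>k. \<integral>\<xi>. (cmod (fourier f \<xi>))\<^sup>2 * gauss (c k *\<^sub>R \<xi>) \<partial>lborel) \<longlonglongrightarrow> (norm_L2 lborel f)\<^sup>2"
    by (simp only: weight)
  have nn: "(\<integral>\<^sup>+\<xi>. ennreal ((cmod (fourier f \<xi>))\<^sup>2 * gauss (c k *\<^sub>R \<xi>)) \<partial>lborel) = ennreal (\<integral>\<xi>. (cmod (fourier f \<xi>))\<^sup>2 * gauss (c k *\<^sub>R \<xi>) \<partial>lborel)" for k
  proof (rule nn_integral_eq_integral)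
    let ?B = "\<integral>x. cmod (f x) \<partial>lborel"
    have "integrable lborel (\<lambda>\<xi>. ?B\<^sup>2 * gauss (c k *\<^sub>R (\<xi>::'a)))"
      using c[of k] by (intro integrable_mult_right lborel_integrable_scale gauss_integrable) auto
    then show "integrable lborel (\<lambda>\<xi>. (cmod (fourier f \<xi>))\<^sup>2 * gauss (c k *\<^sub>R \<xi>))"
      by (rule Bochner_Integration.integrable_bound) (auto intro!: mult_right_mono power_mono fourier_bound)
  qed auto
  have "(\<lambda>k. \<integral>\<^sup>+\<xi>. ennreal ((cmod (fourier f \<xi>))\<^sup>2 * gauss (c k *\<^sub>R \<xi>)) \<partial>lborel) \<longlonglongrightarrow> (\<integral>\<^sup>+\<xi>. ennreal ((cmod (fourier f \<xi>))\<^sup>2) \<partial>lborel)"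
  proof (rule nn_integral_LIMSEQ)
    show "incseq (\<lambda>k \<xi>. ennreal ((cmod (fourier f \<xi>))\<^sup>2 * gauss (c k *\<^sub>R \<xi>)))"
    proof (intro incseq_SucI le_funI ennreal_leI mult_left_mono)
      fix k and \<xi> :: 'a
      have "c (Suc k) \<le> c k" by (simp add: c_def field_simps)
      then have "c (Suc k) * c (Suc k) \<le> c k * c k"
        using c[of k] c[of "Suc k"] by (intro mult_mono) auto
      then have "c (Suc k) * c (Suc k) * (\<xi> \<bullet> \<xi>) \<le> c k * c k * (\<xi> \<bullet> \<xi>)"
        by (intro mult_right_mono) auto
      then show "gauss (c k *\<^sub>R \<xi>) \<le> gauss (c (Suc k) *\<^sub>R \<xi>)"
        by (simp add: gauss_def mult.assoc)
    qed simp
    fix \<xi> :: 'a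
    have "(\<lambda>k. c k *\<^sub>R \<xi>) \<longlonglongrightarrow> 0 *\<^sub>R \<xi>" by (intro tendsto_intros c0)
    then have "(\<lambda>k. (cmod (fourier f \<xi>))\<^sup>2 * gauss (c k *\<^sub>R \<xi>)) \<longlonglongrightarrow> (cmod (fourier f \<xi>))\<^sup>2 * exp (- pi * (0 \<bullet> (0::'a)))"
      unfolding gauss_def by (intro tendsto_intros) simp_all
    then show "(\<lambda>k. ennreal ((cmod (fourier f \<xi>))\<^sup>2 * gauss (c k *\<^sub>R \<xi>))) \<longlonglongrightarrow> ennreal ((cmod (fourier f \<xi>))\<^sup>2)"
      by (intro tendsto_ennrealI) simp
  qed measurable
  then have "(\<lambda>k. ennreal (\<integral>\<xi>. (cmod (fourier f \<xi>))\<^sup>2 * gauss (c k *\<^sub>R \<xi>) \<partial>lborel)) \<longlonglongrightarrow> energy lborel (fourier f)"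
    unfolding nn energy_def .
  moreover have "(\<lambda>k. ennreal (\<integral>\<xi>. (cmod (fourier f \<xi>))\<^sup>2 * gauss (c k *\<^sub>R \<xi>) \<partial>lborel)) \<longlonglongrightarrow> energy lborel f"
    unfolding energy_eq_norm_L2[OF f2] by (intro tendsto_ennrealI lim)
  ultimately show ?thesis by (rule LIMSEQ_unique)
qed

section \<open>Functions of two variables\<close>

lemma borel_measurable_fst [measurable]: "fst \<in> borel_measurable (borel :: ('a::second_countable_topology \<times> 'b::second_countable_topology) measure)"
  and borel_measurable_snd [measurable]: "snd \<in> borel_measurable (borel :: ('a::second_countable_topology \<times> 'b::second_countable_topology) measure)"
  by (auto intro!: borel_measurable_continuous_onI continuous_intros)

lemma
  fixes f :: "'a::euclidean_space \<times> 'b::euclidean_space \<Rightarrow> complex"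
  assumes [measurable]: "f \<in> borel_measurable borel"
  shows energy_fst: "energy lborel f = (\<integral>\<^sup>+x. energy lborel (\<lambda>y. f (x, y)) \<partial>lborel)"
    and energy_snd: "energy lborel f = (\<integral>\<^sup>+y. energy lborel (\<lambda>x. f (x, y)) \<partial>lborel)"
proof -
  have m: "(\<lambda>z. ennreal ((cmod (f z))\<^sup>2)) \<in> borel_measurable (lborel \<Otimes>\<^sub>M lborel)"
    unfolding lborel_prod by measurable
  show "energy lborel f = (\<integral>\<^sup>+x. energy lborel (\<lambda>y. f (x, y)) \<partial>lborel)"
    using lborel.nn_integral_fst[OF m] by (simp add: energy_def lborel_prod)
  show "energy lborel f = (\<integral>\<^sup>+y. energy lborel (\<lambda>x. f (x, y)) \<partial>lborel)"
    using lborel_pair.nn_integral_snd[OF m] by (simp add: energy_def lborel_prod)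
qed

lemma AE_lborel_prod:
  fixes P :: "'a::euclidean_space \<times> 'b::euclidean_space \<Rightarrow> bool"
  assumes "{z. P z} \<in> sets borel" "AE x in lborel. AE y in lborel. P (x, y)"
  shows "AE z in lborel. P z"
proof -
  have "AE z in lborel \<Otimes>\<^sub>M lborel. P z"
  proof (rule lborel_pair.AE_pair_measure)
    show "{z \<in> space (lborel \<Otimes>\<^sub>M lborel). P z} \<in> sets (lborel \<Otimes>\<^sub>M lborel)"
      unfolding lborel_prod using assms(1) by simp
  qed (rule assms(2))
  then show ?thesis unfolding lborel_prod .
qed

section \<open>Modulated translations\<close>

text \<open>
  Twisted translations, and the operators that correspond to them on the side of the Weyl kernels, are
  both of this form.
\<close>

definition modulated_shift :: "('a::euclidean_space \<Rightarrow> real) \<Rightarrow> 'a \<Rightarrow> ('a \<Rightarrow> complex) \<Rightarrow> 'a \<Rightarrow> complex" where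
  "modulated_shift \<theta> a f z = cis (\<theta> z) * f (z + a)"

lemma modulated_shift_measurable:
  assumes [measurable]: "\<theta> \<in> borel_measurable borel" "f \<in> borel_measurable borel"
  shows "modulated_shift \<theta> a f \<in> borel_measurable borel"
  unfolding modulated_shift_def[abs_def] by measurable

lemma
  assumes \<theta>: "\<theta> \<in> borel_measurable borel" and f: "f \<in> L2_space lborel"
  shows L2_modulated_shift: "modulated_shift \<theta> a f \<in> L2_space lborel"
    and norm_L2_modulated_shift: "norm_L2 lborel (modulated_shift \<theta> a f) = norm_L2 lborel f"
proof -
  have [measurable]: "f \<in> borel_measurable borel" using L2_spaceD[OF f] by simp
  have e: "cmod (modulated_shift \<theta> a f z) = cmod (f (z + a))" for z
    by (simp add: modulated_shift_def norm_mult)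
  show "norm_L2 lborel (modulated_shift \<theta> a f) = norm_L2 lborel f"
    using norm_L2_translate[of f a] by (simp add: norm_L2_def e)
  show "modulated_shift \<theta> a f \<in> L2_space lborel"
    using L2_translate[OF f, of a] modulated_shift_measurable[OF \<theta>, of f a] by (simp add: L2_space_def e)
qed

lemma norm_L2_sum_modulated_shift_le:
  assumes "finite I" and \<theta>: "\<And>i. i \<in> I \<Longrightarrow> \<theta> i \<in> borel_measurable borel" and f: "f \<in> L2_space lborel"
  shows "norm_L2 lborel (\<lambda>z. \<Sum>i\<in>I. c i * modulated_shift (\<theta> i) (a i) f z) \<le> (\<Sum>i\<in>I. cmod (c i)) * norm_L2 lborel f"
  using assms(1,2)
proof (induction I rule: finite_induct)
  case empty
  then show ?case by (simp add: norm_L2_def)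
next
  case (insert i I)
  have L: "modulated_shift (\<theta> j) (a j) f \<in> L2_space lborel" if "j \<in> insert i I" for j
    using insert that by (intro L2_modulated_shift f) auto
  have "norm_L2 lborel (\<lambda>z. c i * modulated_shift (\<theta> i) (a i) f z) = cmod (c i) * norm_L2 lborel (modulated_shift (\<theta> i) (a i) f)"
    by (simp add: norm_L2_def norm_mult power_mult_distrib real_sqrt_mult)
  also have "\<dots> = cmod (c i) * norm_L2 lborel f"
    using insert by (subst norm_L2_modulated_shift) (auto intro: f)
  finally have 1: "norm_L2 lborel (\<lambda>z. c i * modulated_shift (\<theta> i) (a i) f z) = cmod (c i) * norm_L2 lborel f" .
  have "norm_L2 lborel (\<lambda>z. \<Sum>i\<in>insert i I. c i * modulated_shift (\<theta> i) (a i) f z)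
    \<le> norm_L2 lborel (\<lambda>z. c i * modulated_shift (\<theta> i) (a i) f z) + norm_L2 lborel (\<lambda>z. \<Sum>i\<in>I. c i * modulated_shift (\<theta> i) (a i) f z)"
    using insert.hyps by (simp add: norm_L2_triangle L2_cmult L2_sum L)
  then show ?case
    using insert 1 by (simp add: distrib_right)
qed

lemma norm_L2_sum_modulated_shift_tendsto:
  assumes I: "finite I" and \<theta>: "\<And>i. i \<in> I \<Longrightarrow> \<theta> i \<in> borel_measurable borel"
    and h: "\<And>r. h r \<in> L2_space lborel" and f: "f \<in> L2_space lborel"
    and lim: "((\<lambda>r. norm_L2 lborel (\<lambda>z. h r z - f z)) \<longlongrightarrow> 0) F"
  shows "((\<lambda>r. norm_L2 lborel (\<lambda>z. \<Sum>i\<in>I. c i * modulated_shift (\<theta> i) (a i) (h r) z))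
     \<longlongrightarrow> norm_L2 lborel (\<lambda>z. \<Sum>i\<in>I. c i * modulated_shift (\<theta> i) (a i) f z)) F"
proof -
  let ?S = "\<lambda>g z. \<Sum>i\<in>I. c i * modulated_shift (\<theta> i) (a i) g z"
  let ?C = "\<Sum>i\<in>I. cmod (c i)"
  have L: "?S g \<in> L2_space lborel" if "g \<in> L2_space lborel" for g
    using \<theta> that by (intro L2_sum L2_cmult L2_modulated_shift) auto
  have diff: "(\<lambda>z. ?S g1 z - ?S g2 z) = ?S (\<lambda>z. g1 z - g2 z)" for g1 g2
    by (simp add: modulated_shift_def sum_subtractf algebra_simps)
  have est: "\<bar>norm_L2 lborel (?S (h r)) - norm_L2 lborel (?S f)\<bar> \<le> ?C * norm_L2 lborel (\<lambda>z. h r z - f z)" for r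
  proof -
    have "norm_L2 lborel (\<lambda>z. ?S (h r) z - ?S f z) \<le> ?C * norm_L2 lborel (\<lambda>z. h r z - f z)"
      unfolding diff by (rule norm_L2_sum_modulated_shift_le[OF I \<theta> L2_diff[OF h f]])
    moreover have "norm_L2 lborel (?S (h r)) \<le> norm_L2 lborel (?S f) + norm_L2 lborel (\<lambda>z. ?S (h r) z - ?S f z)"
      by (intro norm_L2_le_add_diff L h f)
    moreover have "norm_L2 lborel (?S f) \<le> norm_L2 lborel (?S (h r)) + norm_L2 lborel (\<lambda>z. ?S (h r) z - ?S f z)"
      by (subst norm_L2_minus_commute) (intro norm_L2_le_add_diff L h f)
    ultimately show ?thesis by simp
  qed
  have "((\<lambda>r. norm_L2 lborel (?S (h r)) - norm_L2 lborel (?S f)) \<longlongrightarrow> 0) F"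
  proof (rule Lim_null_comparison)
    show "\<forall>\<^sub>F r in F. norm (norm_L2 lborel (?S (h r)) - norm_L2 lborel (?S f)) \<le> ?C * norm_L2 lborel (\<lambda>z. h r z - f z)"
      using est by (auto intro!: always_eventually)
    show "((\<lambda>r. ?C * norm_L2 lborel (\<lambda>z. h r z - f z)) \<longlongrightarrow> 0) F"
      using tendsto_mult[OF tendsto_const lim, of ?C] by simp
  qed
  then show ?thesis by (simp add: LIM_zero_iff)
qed

section \<open>The Weyl kernel\<close>

text \<open>
  The integral that defines the Weyl kernel, without truncation. It is applied to functions whose support is
  bounded in the first variable, for which it converges absolutely at almost every point.
\<close>

definition weyl_integral :: "((real ^ 'n) \<times> (real ^ 'n) \<Rightarrow> complex) \<Rightarrow> (real ^ 'n) \<times> (real ^ 'n) \<Rightarrow> complex" where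
  "weyl_integral f z = (\<integral>x. f (x, snd z - fst z) * cis (pi * (x \<bullet> (fst z + snd z))) \<partial>lborel)"

definition cutoff :: "real \<Rightarrow> ('a::euclidean_space \<times> 'b \<Rightarrow> complex) \<Rightarrow> 'a \<times> 'b \<Rightarrow> complex" where
  "cutoff R f z = (if norm (fst z) \<le> R then f z else 0)"

lemma weyl_kernel_truncated_eq: "weyl_kernel_truncated f R = weyl_integral (cutoff R f)"
  unfolding weyl_kernel_truncated_def weyl_integral_def set_lebesgue_integral_def cutoff_def
  by (auto simp: fun_eq_iff intro!: Bochner_Integration.integral_cong)

lemma weyl_integral_eq_fourier:
  "weyl_integral f (\<xi>, \<eta>) = fourier (\<lambda>x. f (x, \<eta> - \<xi>)) ((1/2) *\<^sub>R (\<xi> + \<eta>))"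
  unfolding weyl_integral_def fourier_def by simp

lemma weyl_integral_measurable [measurable]:
  assumes [measurable]: "f \<in> borel_measurable borel"
  shows "weyl_integral f \<in> borel_measurable borel"
  unfolding weyl_integral_def[abs_def] by measurable

lemma cutoff_measurable [measurable]:
  fixes f :: "'a::euclidean_space \<times> 'b::euclidean_space \<Rightarrow> complex"
  assumes [measurable]: "f \<in> borel_measurable borel"
  shows "cutoff R f \<in> borel_measurable borel"
  unfolding cutoff_def[abs_def] by measurable

text \<open>
  Unlike the class of functions cut off at a fixed radius, this class is closed under twisted translations and
  linear combinations.
\<close>

definition x_bounded :: "('a::euclidean_space \<times> 'b \<Rightarrow> complex) \<Rightarrow> bool" where
  "x_bounded f \<longleftrightarrow> (\<exists>R. \<forall>x y. f (x, y) \<noteq> 0 \<longrightarrow> norm x \<le> R)"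

text \<open>
  The product of \<open>f\<close> with the indicator of a ball, which is square integrable, is \<open>f\<close> itself.
\<close>

lemma L2_bounded_support_integrable:
  fixes f :: "'a::euclidean_space \<Rightarrow> complex"
  assumes f: "f \<in> L2_space lborel" and R: "\<And>x. f x \<noteq> 0 \<Longrightarrow> norm x \<le> R"
  shows "integrable lborel f"
proof -
  have "emeasure lborel (cball (0::'a) R) < \<infinity>"
    by (rule emeasure_bounded_finite) simp
  moreover have "ennreal ((cmod (indicator (cball 0 R) x))\<^sup>2) = indicator (cball 0 R) x" for x :: 'a
    by (simp add: indicator_def)
  ultimately have "(indicator (cball 0 R) :: 'a \<Rightarrow> complex) \<in> L2_space lborel"
    by (auto simp: L2_space_iff_energy energy_def intro!: borel_measurable_indicator)
  from L2_product_integrable[OF f this]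
  show ?thesis
    by (rule Bochner_Integration.integrable_cong[THEN iffD1, rotated -1]) (use R in \<open>auto simp: indicator_def\<close>)
qed

lemma AE_slice_L2:
  fixes f :: "'a::euclidean_space \<times> 'b::euclidean_space \<Rightarrow> complex"
  assumes f: "f \<in> L2_space lborel"
  shows "AE y in lborel. (\<lambda>x. f (x, y)) \<in> L2_space lborel"
proof -
  have [measurable]: "f \<in> borel_measurable borel" using L2_spaceD[OF f] by simp
  have m: "(\<lambda>y. energy lborel (\<lambda>x. f (x, y))) \<in> borel_measurable borel"
    unfolding energy_def by measurable
  have "(\<integral>\<^sup>+y. energy lborel (\<lambda>x. f (x, y)) \<partial>lborel) \<noteq> \<infinity>"
    using f energy_snd[of f] by (auto simp: L2_space_iff_energy)
  then have "AE y in lborel. energy lborel (\<lambda>x. f (x, y)) \<noteq> \<infinity>"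
    using m by (intro nn_integral_noteq_infinite) auto
  then show ?thesis
    by eventually_elim (auto simp: L2_space_iff_energy top.not_eq_extremum)
qed

lemma AE_slice_integrable:
  fixes f :: "'a::euclidean_space \<times> 'b::euclidean_space \<Rightarrow> complex"
  assumes f: "f \<in> L2_space lborel" and "x_bounded f"
  shows "AE y in lborel. integrable lborel (\<lambda>x. f (x, y))"
proof -
  obtain R where R: "\<And>x y. f (x, y) \<noteq> 0 \<Longrightarrow> norm x \<le> R" using assms(2) unfolding x_bounded_def by blast
  show ?thesis
    using AE_slice_L2[OF f] by eventually_elim (rule L2_bounded_support_integrable, auto intro: R)
qed

text \<open>
  In the coordinates \<open>\<xi>\<close> and \<open>y = \<eta> - \<xi>\<close> the integral is the Fourier transform of the slice \<open>f(\<cdot>, y)\<close> at \<open>\<xi> + y/2\<close>.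
  The Plancherel theorem applies to each slice, and the shift by \<open>y/2\<close> does not change the integral over \<open>\<xi>\<close>.
\<close>

lemma energy_weyl_integral:
  fixes f :: "(real ^ 'n) \<times> (real ^ 'n) \<Rightarrow> complex"
  assumes f: "f \<in> L2_space lborel" and b: "x_bounded f"
  shows "energy lborel (weyl_integral f) = energy lborel f"
proof -
  have [measurable]: "f \<in> borel_measurable borel" using L2_spaceD[OF f] by simp
  let ?g = "\<lambda>y \<xi>. ennreal ((cmod (fourier (\<lambda>x. f (x, y)) (\<xi> + (1/2) *\<^sub>R y)))\<^sup>2)"
  have m: "(\<lambda>(\<xi>, y). fourier (\<lambda>x. f (x, y)) (\<xi> + (1/2) *\<^sub>R y)) \<in> borel_measurable (borel \<Otimes>\<^sub>M borel)"
    unfolding fourier_def by measurable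
  then have m': "(\<lambda>(\<xi>, y). ?g y \<xi>) \<in> borel_measurable (lborel \<Otimes>\<^sub>M lborel)"
    by simp
  have "energy lborel (weyl_integral f) = (\<integral>\<^sup>+\<xi>. \<integral>\<^sup>+\<eta>. ennreal ((cmod (weyl_integral f (\<xi>, \<eta>)))\<^sup>2) \<partial>lborel \<partial>lborel)"
    by (subst energy_fst) (auto simp: energy_def)
  also have "\<dots> = (\<integral>\<^sup>+\<xi>. \<integral>\<^sup>+y. ?g y \<xi> \<partial>lborel \<partial>lborel)"
  proof (rule nn_integral_cong)
    fix \<xi> :: "real ^ 'n"
    have "(\<integral>\<^sup>+\<eta>. ennreal ((cmod (weyl_integral f (\<xi>, \<eta>)))\<^sup>2) \<partial>lborel) = (\<integral>\<^sup>+y. ennreal ((cmod (weyl_integral f (\<xi>, y + \<xi>)))\<^sup>2) \<partial>lborel)"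
      by (rule nn_integral_lborel_translate[symmetric]) measurable
    also have "\<dots> = (\<integral>\<^sup>+y. ?g y \<xi> \<partial>lborel)"
    proof (intro nn_integral_cong)
      fix y :: "real ^ 'n"
      have "(1/2) *\<^sub>R (\<xi> + (y + \<xi>)) = \<xi> + (1/2) *\<^sub>R y"
        by (simp add: vec_eq_iff field_simps)
      then show "ennreal ((cmod (weyl_integral f (\<xi>, y + \<xi>)))\<^sup>2) = ?g y \<xi>"
        by (simp add: weyl_integral_eq_fourier)
    qed
    finally show "(\<integral>\<^sup>+\<eta>. ennreal ((cmod (weyl_integral f (\<xi>, \<eta>)))\<^sup>2) \<partial>lborel) = (\<integral>\<^sup>+y. ?g y \<xi> \<partial>lborel)" .
  qed
  also have "\<dots> = (\<integral>\<^sup>+y. \<integral>\<^sup>+\<xi>. ?g y \<xi> \<partial>lborel \<partial>lborel)"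
    by (rule lborel_pair.Fubini'[symmetric, OF m'])
  also have "\<dots> = (\<integral>\<^sup>+y. energy lborel (\<lambda>x. f (x, y)) \<partial>lborel)"
  proof (intro nn_integral_cong_AE)
    show "AE y in lborel. (\<integral>\<^sup>+\<xi>. ?g y \<xi> \<partial>lborel) = energy lborel (\<lambda>x. f (x, y))"
      using AE_slice_L2[OF f] AE_slice_integrable[OF f b]
    proof eventually_elim
      case (elim y)
      have "(\<integral>\<^sup>+\<xi>. ?g y \<xi> \<partial>lborel) = energy lborel (fourier (\<lambda>x. f (x, y)))"
        unfolding energy_def by (rule nn_integral_lborel_translate) measurable
      then show ?case using Plancherel[OF elim(2,1)] by simp
    qed
  qed
  also have "\<dots> = energy lborel f" by (rule energy_snd[symmetric]) measurable
  finally show ?thesis .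
qed

lemma L2_weyl_integral:
  fixes f :: "(real ^ 'n) \<times> (real ^ 'n) \<Rightarrow> complex"
  assumes "f \<in> L2_space lborel" "x_bounded f"
  shows "weyl_integral f \<in> L2_space lborel"
  using assms energy_weyl_integral[OF assms] by (auto simp: L2_space_iff_energy)

lemma AE_weyl_integrand_integrable:
  fixes f :: "(real ^ 'n) \<times> (real ^ 'n) \<Rightarrow> complex"
  assumes f: "f \<in> L2_space lborel" and b: "x_bounded f"
  shows "AE z in lborel. integrable lborel (\<lambda>x. f (x, snd z - fst z) * cis (pi * (x \<bullet> (fst z + snd z))))"
proof (rule AE_lborel_prod)
  have [measurable]: "f \<in> borel_measurable borel" using L2_spaceD[OF f] by simp
  have eq: "integrable lborel (\<lambda>x. f (x, snd z - fst z) * cis (pi * (x \<bullet> (fst z + snd z)))) \<longleftrightarrow>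
    (\<integral>\<^sup>+x. ennreal (cmod (f (x, snd z - fst z))) \<partial>lborel) < \<infinity>" for z
    by (auto simp: integrable_iff_bounded norm_mult)
  show "{z. integrable lborel (\<lambda>x. f (x, snd z - fst z) * cis (pi * (x \<bullet> (fst z + snd z))))} \<in> sets borel"
    unfolding eq by measurable
  show "AE \<xi> in lborel. AE \<eta> in lborel. integrable lborel (\<lambda>x. f (x, snd (\<xi>, \<eta>) - fst (\<xi>, \<eta>)) * cis (pi * (x \<bullet> (fst (\<xi>, \<eta>) + snd (\<xi>, \<eta>)))))"
  proof (rule AE_I2)
    fix \<xi> :: "real ^ 'n"
    have "AE \<eta> in lborel. integrable lborel (\<lambda>x. f (x, \<eta> + (- \<xi>)))"
      by (rule lborel_AE_translate[OF AE_slice_integrable[OF f b]])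
    then show "AE \<eta> in lborel. integrable lborel (\<lambda>x. f (x, snd (\<xi>, \<eta>) - fst (\<xi>, \<eta>)) * cis (pi * (x \<bullet> (fst (\<xi>, \<eta>) + snd (\<xi>, \<eta>)))))"
      by eventually_elim (auto simp: eq integrable_iff_bounded norm_mult)
  qed
qed

lemma x_bounded_cutoff: "x_bounded (cutoff R f)"
  unfolding x_bounded_def cutoff_def by auto

lemma x_bounded_diff:
  assumes "x_bounded f" "x_bounded g" shows "x_bounded (\<lambda>z. f z - g z)"
proof -
  obtain R S where "\<And>x y. f (x, y) \<noteq> 0 \<Longrightarrow> norm x \<le> R" "\<And>x y. g (x, y) \<noteq> 0 \<Longrightarrow> norm x \<le> S"
    using assms unfolding x_bounded_def by blast
  then show ?thesis unfolding x_bounded_def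
    by (intro exI[of _ "max R S"]) (metis diff_zero le_max_iff_disj)
qed

lemma x_bounded_sum:
  assumes "finite I" "\<And>i. i \<in> I \<Longrightarrow> x_bounded (f i)" shows "x_bounded (\<lambda>z. \<Sum>i\<in>I. c i * f i z)"
  using assms
proof (induction I rule: finite_induct)
  case (insert i I)
  obtain R where R: "\<And>x y. f i (x, y) \<noteq> 0 \<Longrightarrow> norm x \<le> R"
    using insert unfolding x_bounded_def by blast
  have "x_bounded (\<lambda>z. \<Sum>i\<in>I. c i * f i z)" using insert by auto
  then obtain S where S: "\<And>x y. (\<Sum>i\<in>I. c i * f i (x, y)) \<noteq> 0 \<Longrightarrow> norm x \<le> S"
    unfolding x_bounded_def by blast
  have "norm x \<le> max R S" if "(\<Sum>i\<in>insert i I. c i * f i (x, y)) \<noteq> 0" for x y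
    using R[of x y] S[of x y] that insert.hyps by (cases "f i (x, y) = 0") (auto simp: le_max_iff_disj)
  then show ?case unfolding x_bounded_def by blast
qed (simp add: x_bounded_def)

lemma L2_cutoff:
  fixes f :: "'a::euclidean_space \<times> 'b::euclidean_space \<Rightarrow> complex"
  assumes f: "f \<in> L2_space lborel" shows "cutoff R f \<in> L2_space lborel"
proof -
  have [measurable]: "f \<in> borel_measurable borel" using L2_spaceD[OF f] by simp
  have "energy lborel (cutoff R f) \<le> energy lborel f"
    unfolding energy_def by (intro nn_integral_mono ennreal_leI) (auto simp: cutoff_def)
  then show ?thesis using f by (auto simp: L2_space_iff_energy)
qed

lemma cutoff_tendsto:
  fixes f :: "'a::euclidean_space \<times> 'b::euclidean_space \<Rightarrow> complex"
  assumes f: "f \<in> L2_space lborel"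
  shows "((\<lambda>R. norm_L2 lborel (\<lambda>z. cutoff R f z - f z)) \<longlongrightarrow> 0) at_top"
proof -
  have [measurable]: "f \<in> borel_measurable borel" using L2_spaceD[OF f] by simp
  have "((\<lambda>R. \<integral>z. (cmod (cutoff R f z - f z))\<^sup>2 \<partial>lborel) \<longlongrightarrow> (\<integral>z. 0 \<partial>(lborel :: ('a \<times> 'b) measure))) at_top"
  proof (rule integral_dominated_convergence_at_top[where w = "\<lambda>z. (cmod (f z))\<^sup>2"])
    show "AE z in lborel. ((\<lambda>R. (cmod (cutoff R f z - f z))\<^sup>2) \<longlongrightarrow> 0) at_top"
    proof (rule AE_I2)
      fix z
      have "\<forall>\<^sub>F R in at_top. (cmod (cutoff R f z - f z))\<^sup>2 = 0"
        using eventually_ge_at_top[of "norm (fst z)"] by eventually_elim (simp add: cutoff_def)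
      then show "((\<lambda>R. (cmod (cutoff R f z - f z))\<^sup>2) \<longlongrightarrow> 0) at_top" by (rule tendsto_eventually)
    qed
    show "integrable lborel (\<lambda>z. (cmod (f z))\<^sup>2)" using f by (simp add: L2_space_def)
    show "\<forall>\<^sub>F R in at_top. AE z in lborel. norm ((cmod (cutoff R f z - f z))\<^sup>2) \<le> (cmod (f z))\<^sup>2"
      by (intro always_eventually allI AE_I2) (auto simp: cutoff_def)
  qed auto
  then have "((\<lambda>R. sqrt (\<integral>z. (cmod (cutoff R f z - f z))\<^sup>2 \<partial>lborel)) \<longlongrightarrow> sqrt 0) at_top"
    by (intro tendsto_real_sqrt) simp
  then show ?thesis by (simp add: norm_L2_def)
qed

lemma norm_L2_energy: "f \<in> L2_space M \<Longrightarrow> norm_L2 M f = sqrt (enn2real (energy M f))"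
  by (simp add: energy_eq_norm_L2)

lemma norm_L2_cong_AE:
  assumes "f \<in> borel_measurable M" "g \<in> borel_measurable M" "AE x in M. f x = g x"
  shows "norm_L2 M f = norm_L2 M g"
proof -
  note [measurable] = assms(1,2)
  have "(\<integral>x. (cmod (f x))\<^sup>2 \<partial>M) = (\<integral>x. (cmod (g x))\<^sup>2 \<partial>M)"
    by (rule integral_cong_AE) (use assms(3) in auto)
  then show ?thesis by (simp add: norm_L2_def)
qed

lemma norm_L2_weyl_integral:
  fixes f :: "(real ^ 'n) \<times> (real ^ 'n) \<Rightarrow> complex"
  assumes "f \<in> L2_space lborel" "x_bounded f"
  shows "norm_L2 lborel (weyl_integral f) = norm_L2 lborel f"
  using assms by (simp add: norm_L2_energy L2_weyl_integral energy_weyl_integral)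

lemma norm_L2_weyl_integral_diff:
  fixes f :: "(real ^ 'n) \<times> (real ^ 'n) \<Rightarrow> complex"
  assumes f: "f \<in> L2_space lborel" "x_bounded f" and g: "g \<in> L2_space lborel" "x_bounded g"
  shows "norm_L2 lborel (\<lambda>z. weyl_integral f z - weyl_integral g z) = norm_L2 lborel (\<lambda>z. f z - g z)"
proof -
  have [measurable]: "f \<in> borel_measurable borel" "g \<in> borel_measurable borel"
    using L2_spaceD[OF f(1)] L2_spaceD[OF g(1)] by auto
  have "norm_L2 lborel (\<lambda>z. weyl_integral f z - weyl_integral g z) = norm_L2 lborel (weyl_integral (\<lambda>z. f z - g z))"
  proof (rule norm_L2_cong_AE)
    show "AE z in lborel. weyl_integral f z - weyl_integral g z = weyl_integral (\<lambda>z. f z - g z) z"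
      using AE_weyl_integrand_integrable[OF f] AE_weyl_integrand_integrable[OF g]
      by eventually_elim (simp add: weyl_integral_def left_diff_distrib)
  qed auto
  also have "\<dots> = norm_L2 lborel (\<lambda>z. f z - g z)"
    by (intro norm_L2_weyl_integral L2_diff x_bounded_diff f g)
  finally show ?thesis .
qed

text \<open>
  The integral operator is isometric on cut off functions, so the truncated kernels are Cauchy because the cut off
  functions are; completeness provides the limit that the choice operator in \<open>weyl_kernel\<close> asks for.
\<close>

theorem weyl_kernel_tendsto:
  assumes f: "f \<in> L2_space lborel"
  shows "tendsto_L2 lborel (weyl_kernel_truncated f) (weyl_kernel f) at_top"
proof -
  have L: "weyl_kernel_truncated f R \<in> L2_space lborel" for R
    unfolding weyl_kernel_truncated_eq by (intro L2_weyl_integral L2_cutoff f x_bounded_cutoff)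
  have close: "\<exists>R0. \<forall>R\<ge>R0. \<forall>S\<ge>R0. norm_L2 lborel (\<lambda>z. weyl_kernel_truncated f R z - weyl_kernel_truncated f S z) \<le> e"
    if e: "0 < e" for e
  proof -
    have "\<forall>\<^sub>F R in at_top. norm_L2 lborel (\<lambda>z. cutoff R f z - f z) < e/2"
      using order_tendstoD(2)[OF cutoff_tendsto[OF f], of "e/2"] e by simp
    then obtain R0 where R0: "\<And>R. R \<ge> R0 \<Longrightarrow> norm_L2 lborel (\<lambda>z. cutoff R f z - f z) < e/2"
      by (auto simp: eventually_at_top_linorder)
    have "norm_L2 lborel (\<lambda>z. weyl_kernel_truncated f R z - weyl_kernel_truncated f S z) \<le> e" if "R \<ge> R0" "S \<ge> R0" for R S
    proof -
      have "norm_L2 lborel (\<lambda>z. weyl_kernel_truncated f R z - weyl_kernel_truncated f S z) = norm_L2 lborel (\<lambda>z. cutoff R f z - cutoff S f z)"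
        unfolding weyl_kernel_truncated_eq by (intro norm_L2_weyl_integral_diff L2_cutoff f x_bounded_cutoff)
      also have "\<dots> \<le> norm_L2 lborel (\<lambda>z. cutoff R f z - f z) + norm_L2 lborel (\<lambda>z. f z - cutoff S f z)"
        by (intro norm_L2_triangle_diff L2_cutoff f)
      also have "norm_L2 lborel (\<lambda>z. f z - cutoff S f z) = norm_L2 lborel (\<lambda>z. cutoff S f z - f z)"
        by (rule norm_L2_minus_commute)
      finally show ?thesis using R0[OF that(1)] R0[OF that(2)] by simp
    qed
    then show ?thesis by blast
  qed
  have "\<exists>K. K \<in> L2_space lborel \<and> (\<lambda>n. norm_L2 lborel (\<lambda>z. weyl_kernel_truncated f (real n) z - K z)) \<longlonglongrightarrow> 0"
  proof (rule L2_complete)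
    fix e :: real assume "0 < e"
    from close[OF this] obtain R0 where R0: "\<forall>R\<ge>R0. \<forall>S\<ge>R0. norm_L2 lborel (\<lambda>z. weyl_kernel_truncated f R z - weyl_kernel_truncated f S z) \<le> e" by blast
    obtain N where "R0 \<le> real N" using real_arch_simple by blast
    then show "\<exists>N. \<forall>m\<ge>N. \<forall>n\<ge>N. norm_L2 lborel (\<lambda>z. weyl_kernel_truncated f (real m) z - weyl_kernel_truncated f (real n) z) \<le> e"
      by (intro exI[of _ N]) (use R0 in \<open>auto intro: order_trans\<close>)
  qed (rule L)
  then obtain K where K: "K \<in> L2_space lborel" and lim: "(\<lambda>n. norm_L2 lborel (\<lambda>z. weyl_kernel_truncated f (real n) z - K z)) \<longlonglongrightarrow> 0" by blast
  have "((\<lambda>R. norm_L2 lborel (\<lambda>z. weyl_kernel_truncated f R z - K z)) \<longlongrightarrow> 0) at_top"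
  proof (rule tendstoI)
    fix e :: real assume e: "0 < e"
    obtain R0 where R0: "\<forall>R\<ge>R0. \<forall>S\<ge>R0. norm_L2 lborel (\<lambda>z. weyl_kernel_truncated f R z - weyl_kernel_truncated f S z) \<le> e/2"
      using close[of "e/2"] e by auto
    obtain n1 where n1: "R0 \<le> real n1" using real_arch_simple by blast
    obtain n2 where n2: "\<And>n. n \<ge> n2 \<Longrightarrow> norm_L2 lborel (\<lambda>z. weyl_kernel_truncated f (real n) z - K z) < e/2"
      using LIMSEQ_D[OF lim, of "e/2"] e by auto
    define n where "n = max n1 n2"
    have n: "R0 \<le> real n" "n2 \<le> n" using n1 by (auto simp: n_def)
    have "norm_L2 lborel (\<lambda>z. weyl_kernel_truncated f R z - K z) < e" if "R \<ge> R0" for R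
    proof -
      have "norm_L2 lborel (\<lambda>z. weyl_kernel_truncated f R z - K z) \<le>
        norm_L2 lborel (\<lambda>z. weyl_kernel_truncated f R z - weyl_kernel_truncated f (real n) z) + norm_L2 lborel (\<lambda>z. weyl_kernel_truncated f (real n) z - K z)"
        by (intro norm_L2_triangle_diff L K)
      also have "norm_L2 lborel (\<lambda>z. weyl_kernel_truncated f R z - weyl_kernel_truncated f (real n) z) \<le> e/2"
        using R0 that n by blast
      finally show ?thesis using n2[OF n(2)] by simp
    qed
    then show "\<forall>\<^sub>F R in at_top. dist (norm_L2 lborel (\<lambda>z. weyl_kernel_truncated f R z - K z)) 0 < e"
      by (auto simp: eventually_at_top_linorder)
  qed
  with L K have "tendsto_L2 lborel (weyl_kernel_truncated f) K at_top"
    unfolding tendsto_L2_def by blast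
  then show ?thesis
    unfolding weyl_kernel_def by (rule someI[of "\<lambda>K. tendsto_L2 lborel (weyl_kernel_truncated f) K at_top"])
qed

section \<open>Twisted translations and the Weyl kernel\<close>

lemma twisted_translation_eq_modulated_shift:
  "twisted_translation (k, l) f =
     modulated_shift (\<lambda>z. pi * (fst z \<bullet> real_vec l - snd z \<bullet> real_vec k)) (- real_vec k, - real_vec l) f"
  by (auto simp: twisted_translation_def modulated_shift_def fun_eq_iff)

text \<open>
  The effect of a twisted translation by \<open>(k, l)\<close> on Weyl kernels: a shift by \<open>l\<close> in the first variable and a
  modulation that depends on \<open>k\<close>. Up to the constant \<open>cis (pi * (k \<bullet> l))\<close> the modulation is \<open>\<int>\<^sup>n\<close>-periodic in \<open>\<xi>\<close>; it
  therefore commutes with the integer shifts.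
\<close>

definition kernel_shift :: "(int ^ 'n) \<times> (int ^ 'n) \<Rightarrow> ((real ^ 'n) \<times> (real ^ 'n) \<Rightarrow> complex) \<Rightarrow> (real ^ 'n) \<times> (real ^ 'n) \<Rightarrow> complex" where
  "kernel_shift = (\<lambda>(k, l). modulated_shift
     (\<lambda>z. pi * (real_vec k \<bullet> real_vec l + 2 * (real_vec k \<bullet> fst z))) (real_vec l, 0))"

lemma weyl_integral_twisted_translation:
  assumes [measurable]: "f \<in> borel_measurable borel"
  shows "weyl_integral (twisted_translation (k, l) f) z = kernel_shift (k, l) (weyl_integral f) z"
proof -
  obtain \<xi> \<eta> where z: "z = (\<xi>, \<eta>)" by (cases z)
  let ?k = "real_vec k" and ?l = "real_vec l"
  have [measurable]: "twisted_translation (k, l) f \<in> borel_measurable borel"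
    unfolding twisted_translation_eq_modulated_shift by (rule modulated_shift_measurable) measurable
  have "weyl_integral (twisted_translation (k, l) f) z
     = (\<integral>x. twisted_translation (k, l) f (x, \<eta> - \<xi>) * cis (pi * (x \<bullet> (\<xi> + \<eta>))) \<partial>lborel)"
    by (simp add: weyl_integral_def z)
  also have "\<dots> = (\<integral>x. twisted_translation (k, l) f (x + ?k, \<eta> - \<xi>) * cis (pi * ((x + ?k) \<bullet> (\<xi> + \<eta>))) \<partial>lborel)"
    by (rule lborel_integral_translate[symmetric]) measurable
  also have "\<dots> = (\<integral>x. cis (pi * (?k \<bullet> ?l + 2 * (?k \<bullet> \<xi>))) * (f (x, \<eta> - (\<xi> + ?l)) * cis (pi * (x \<bullet> ((\<xi> + ?l) + \<eta>)))) \<partial>lborel)"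
  proof (intro Bochner_Integration.integral_cong refl)
    fix x
    have arg: "(x + ?k) \<bullet> ?l - (\<eta> - \<xi>) \<bullet> ?k + (x + ?k) \<bullet> (\<xi> + \<eta>) = (?k \<bullet> ?l + 2 * (?k \<bullet> \<xi>)) + x \<bullet> ((\<xi> + ?l) + \<eta>)"
      by (simp add: inner_add_left inner_add_right inner_diff_left inner_diff_right inner_commute)
    have "cis (pi * ((x + ?k) \<bullet> ?l - (\<eta> - \<xi>) \<bullet> ?k)) * cis (pi * ((x + ?k) \<bullet> (\<xi> + \<eta>)))
      = cis (pi * (?k \<bullet> ?l + 2 * (?k \<bullet> \<xi>))) * cis (pi * (x \<bullet> ((\<xi> + ?l) + \<eta>)))"
      unfolding cis_mult distrib_left[symmetric] arg ..
    then show "twisted_translation (k, l) f (x + ?k, \<eta> - \<xi>) * cis (pi * ((x + ?k) \<bullet> (\<xi> + \<eta>))) =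
      cis (pi * (?k \<bullet> ?l + 2 * (?k \<bullet> \<xi>))) * (f (x, \<eta> - (\<xi> + ?l)) * cis (pi * (x \<bullet> ((\<xi> + ?l) + \<eta>))))"
      unfolding twisted_translation_def by (simp add: diff_diff_add mult.assoc mult.left_commute)
  qed
  also have "\<dots> = kernel_shift (k, l) (weyl_integral f) z"
    by (simp add: kernel_shift_def modulated_shift_def weyl_integral_def z)
  finally show ?thesis .
qed

lemma weyl_integral_sum_twisted_translation:
  assumes F: "finite F" and f: "f \<in> L2_space lborel" "x_bounded f"
  shows "norm_L2 lborel (\<lambda>z. \<Sum>p\<in>F. c p * twisted_translation p f z) = norm_L2 lborel (\<lambda>z. \<Sum>p\<in>F. c p * kernel_shift p (weyl_integral f) z)"
proof -
  have fm [measurable]: "f \<in> borel_measurable borel" using L2_spaceD[OF f(1)] by simp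
  have tm [measurable]: "twisted_translation p f \<in> borel_measurable borel" for p
    by (cases p) (simp only: twisted_translation_eq_modulated_shift, rule modulated_shift_measurable, measurable)
  have km [measurable]: "kernel_shift p (weyl_integral f) \<in> borel_measurable borel" for p
    unfolding kernel_shift_def by (cases p) (simp only: prod.case, rule modulated_shift_measurable, measurable)
  have tL: "twisted_translation p f \<in> L2_space lborel" for p
    by (cases p) (simp only: twisted_translation_eq_modulated_shift, rule L2_modulated_shift, measurable, rule f)
  have tb: "x_bounded (twisted_translation p f)" for p
  proof -
    obtain k l where p: "p = (k, l)" by (cases p)
    obtain R where R: "\<And>x y. f (x, y) \<noteq> 0 \<Longrightarrow> norm x \<le> R" using f(2) unfolding x_bounded_def by blast
    have "norm x \<le> R + norm (real_vec k)" if "twisted_translation p f (x, y) \<noteq> 0" for x y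
    proof -
      have "norm (x - real_vec k) \<le> R"
        using that by (intro R[of _ "y - real_vec l"]) (auto simp: p twisted_translation_def)
      then show ?thesis using norm_triangle_ineq[of "x - real_vec k" "real_vec k"] by simp
    qed
    then show ?thesis unfolding x_bounded_def by blast
  qed
  have "norm_L2 lborel (\<lambda>z. \<Sum>p\<in>F. c p * twisted_translation p f z) = norm_L2 lborel (weyl_integral (\<lambda>z. \<Sum>p\<in>F. c p * twisted_translation p f z))"
    by (intro norm_L2_weyl_integral[symmetric] L2_sum L2_cmult tL x_bounded_sum tb F)
  also have "\<dots> = norm_L2 lborel (\<lambda>z. \<Sum>p\<in>F. c p * kernel_shift p (weyl_integral f) z)"
  proof (rule norm_L2_cong_AE)
    have "AE z in lborel. \<forall>p\<in>F. integrable lborel (\<lambda>x. twisted_translation p f (x, snd z - fst z) * cis (pi * (x \<bullet> (fst z + snd z))))"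
      using F by (intro AE_finite_allI AE_weyl_integrand_integrable tL tb)
    then show "AE z in lborel. weyl_integral (\<lambda>z. \<Sum>p\<in>F. c p * twisted_translation p f z) z = (\<Sum>p\<in>F. c p * kernel_shift p (weyl_integral f) z)"
    proof eventually_elim
      case (elim z)
      have "weyl_integral (\<lambda>z. \<Sum>p\<in>F. c p * twisted_translation p f z) z
        = (\<integral>x. (\<Sum>p\<in>F. c p * (twisted_translation p f (x, snd z - fst z) * cis (pi * (x \<bullet> (fst z + snd z))))) \<partial>lborel)"
        by (simp add: weyl_integral_def sum_distrib_right mult.assoc)
      also have "\<dots> = (\<Sum>p\<in>F. c p * weyl_integral (twisted_translation p f) z)"
        using elim by (subst Bochner_Integration.integral_sum) (auto simp: weyl_integral_def)
      also have "\<dots> = (\<Sum>p\<in>F. c p * kernel_shift p (weyl_integral f) z)"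
        using weyl_integral_twisted_translation[OF fm] by (intro sum.cong refl) (metis surj_pair)
      finally show ?case .
    qed
  qed measurable
  finally show ?thesis .
qed

text \<open>
  For a function cut off at radius \<open>R\<close> this is the isometry property together with the formula for the kernel of a
  twisted translation. Both sides are continuous in the \<open>L\<^sup>2\<close> norm, and \<open>R\<close> may tend to infinity.
\<close>

theorem norm_L2_sum_twisted_translation:
  assumes F: "finite F" and f: "f \<in> L2_space lborel"
  shows "norm_L2 lborel (\<lambda>z. \<Sum>p\<in>F. c p * twisted_translation p f z) = norm_L2 lborel (\<lambda>z. \<Sum>p\<in>F. c p * kernel_shift p (weyl_kernel f) z)"
proof (rule tendsto_unique)
  have K: "weyl_kernel_truncated f R \<in> L2_space lborel" "weyl_kernel f \<in> L2_space lborel"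
    "((\<lambda>R. norm_L2 lborel (\<lambda>z. weyl_kernel_truncated f R z - weyl_kernel f z)) \<longlongrightarrow> 0) at_top" for R
    using weyl_kernel_tendsto[OF f] unfolding tendsto_L2_def by auto
  have t: "twisted_translation p = modulated_shift (\<lambda>z. pi * (fst z \<bullet> real_vec (snd p) - snd z \<bullet> real_vec (fst p))) (- real_vec (fst p), - real_vec (snd p))" for p
    by (cases p) (simp add: twisted_translation_eq_modulated_shift fun_eq_iff)
  have k: "kernel_shift p = modulated_shift (\<lambda>z. pi * (real_vec (fst p) \<bullet> real_vec (snd p) + 2 * (real_vec (fst p) \<bullet> fst z))) (real_vec (snd p), 0)" for p
    by (cases p) (simp add: kernel_shift_def)
  show "((\<lambda>R. norm_L2 lborel (\<lambda>z. \<Sum>p\<in>F. c p * twisted_translation p (cutoff R f) z)) \<longlongrightarrow> norm_L2 lborel (\<lambda>z. \<Sum>p\<in>F. c p * twisted_translation p f z)) at_top"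
    unfolding t by (rule norm_L2_sum_modulated_shift_tendsto[OF F _ L2_cutoff[OF f] f cutoff_tendsto[OF f]]) measurable
  have "((\<lambda>R. norm_L2 lborel (\<lambda>z. \<Sum>p\<in>F. c p * kernel_shift p (weyl_kernel_truncated f R) z)) \<longlongrightarrow> norm_L2 lborel (\<lambda>z. \<Sum>p\<in>F. c p * kernel_shift p (weyl_kernel f) z)) at_top"
    unfolding k by (rule norm_L2_sum_modulated_shift_tendsto[OF F _ K(1) K(2,3)]) measurable
  then show "((\<lambda>R. norm_L2 lborel (\<lambda>z. \<Sum>p\<in>F. c p * twisted_translation p (cutoff R f) z)) \<longlongrightarrow> norm_L2 lborel (\<lambda>z. \<Sum>p\<in>F. c p * kernel_shift p (weyl_kernel f) z)) at_top"
    unfolding weyl_kernel_truncated_eq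
    by (simp only: weyl_integral_sum_twisted_translation[OF F L2_cutoff[OF f] x_bounded_cutoff])
qed simp

section \<open>Integration and trigonometric polynomials on the torus\<close>

definition unit_cube :: "(real ^ 'n) set" where
  "unit_cube = {x. \<forall>i. 0 \<le> x $ i \<and> x $ i < 1}"

lemma real_vec_add: "real_vec (k + l) = real_vec k + real_vec l"
  and real_vec_diff: "real_vec (k - l) = real_vec k - real_vec l"
  and real_vec_minus: "real_vec (- k) = - real_vec k"
  and real_vec_0 [simp]: "real_vec 0 = 0"
  by (simp_all add: real_vec_def vec_eq_iff)

lemma real_vec_eq_0_iff [simp]: "real_vec k = 0 \<longleftrightarrow> k = 0"
  by (simp add: real_vec_def vec_eq_iff)

lemma vec_nth_measurable [measurable]: "(\<lambda>x :: real ^ 'n. x $ i) \<in> borel_measurable borel"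
  by (intro borel_measurable_continuous_onI continuous_intros)

lemma unit_cube_sets [measurable]: "unit_cube \<in> sets borel"
proof -
  have "{x \<in> space borel. \<forall>i. 0 \<le> x $ i \<and> x $ i < (1::real)} \<in> sets borel" by measurable
  then show ?thesis by (simp add: unit_cube_def)
qed

lemma emeasure_unit_cube_le: "emeasure lborel (unit_cube :: (real ^ 'n) set) \<le> 1"
proof -
  have "unit_cube \<subseteq> cbox 0 (\<chi> i. 1 :: real ^ 'n)"
    by (auto simp: unit_cube_def mem_box_cart less_imp_le)
  then have "emeasure lborel (unit_cube :: (real ^ 'n) set) \<le> emeasure lborel (cbox 0 (\<chi> i. 1 :: real ^ 'n))"
    by (intro emeasure_mono) auto
  also have "\<dots> = 1"
    by (auto simp: emeasure_lborel_cbox_eq Basis_vec_def inner_axis intro!: prod.neutral)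
  finally show ?thesis .
qed

lemma torus_eq: "torus = restrict_space lborel unit_cube"
  by (simp add: torus_def unit_cube_def)

lemma space_torus: "space torus = unit_cube"
  by (simp add: torus_eq space_restrict_space)

lemma measurable_torus [measurable (raw)]: "f \<in> measurable borel M \<Longrightarrow> f \<in> measurable torus M"
  unfolding torus_eq by (rule measurable_restrict_space1) simp

lemma nn_integral_torus: "(\<integral>\<^sup>+x. f x \<partial>torus) = (\<integral>\<^sup>+x. f x * indicator unit_cube x \<partial>lborel)"
  unfolding torus_eq by (rule nn_integral_restrict_space) simp

lemma emeasure_torus_le: "emeasure torus (space torus :: (real ^ 'n) set) \<le> 1"
  using emeasure_unit_cube_le unfolding space_torus by (simp add: torus_eq emeasure_restrict_space)

lemma finite_measure_torus: "finite_measure (torus :: (real ^ 'n) measure)"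
  by standard (use emeasure_torus_le[where 'n = 'n] in \<open>auto simp: top_unique\<close>)

lemma measure_torus_le: "measure torus (space torus :: (real ^ 'n) set) \<le> 1"
  using emeasure_torus_le unfolding measure_def by (intro enn2real_leI) auto

text \<open>
  The integer translates of the half-open cube tile space.
\<close>

lemma nn_integral_unit_cube_translates:
  "(\<integral>\<^sup>+m. indicator unit_cube (x + real_vec m) \<partial>count_space UNIV) = (1 :: ennreal)"
proof -
  \<comment> \<open>the only integer vector that moves \<open>x\<close> into the cube\<close>
  define m0 where "m0 = (\<chi> i. - \<lfloor>x $ i\<rfloor>)"
  have "x + real_vec m \<in> unit_cube \<longleftrightarrow> m = m0" for m
  proof -
    have "0 \<le> x $ i + real_of_int (m $ i) \<and> x $ i + real_of_int (m $ i) < 1 \<longleftrightarrow> m $ i = - \<lfloor>x $ i\<rfloor>" for i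
      by linarith
    then show ?thesis by (simp add: unit_cube_def real_vec_def m0_def vec_eq_iff)
  qed
  then have "(indicator unit_cube (x + real_vec m) :: ennreal) = indicator {m0} m" for m
    by (simp add: indicator_def)
  then show ?thesis by simp
qed

text \<open>
  Write the constant 1 as the sum of the indicators of the translated cubes, and translate each term back to the
  unit cube.
\<close>

lemma nn_integral_lborel_periodize:
  fixes h :: "real ^ 'n \<Rightarrow> ennreal"
  assumes [measurable]: "h \<in> borel_measurable borel"
  shows "(\<integral>\<^sup>+x. h x \<partial>lborel) = (\<integral>\<^sup>+x. (\<integral>\<^sup>+m. h (x + real_vec m) \<partial>count_space UNIV) \<partial>torus)"
proof -
  have "(\<integral>\<^sup>+x. h x \<partial>lborel) = (\<integral>\<^sup>+x. h x * (\<integral>\<^sup>+m. indicator unit_cube (x + real_vec m) \<partial>count_space UNIV) \<partial>lborel)"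
    by (simp add: nn_integral_unit_cube_translates)
  also have "\<dots> = (\<integral>\<^sup>+x. (\<integral>\<^sup>+m. h x * indicator unit_cube (x + real_vec m) \<partial>count_space UNIV) \<partial>lborel)"
    by (simp add: nn_integral_cmult)
  also have "\<dots> = (\<integral>\<^sup>+m. (\<integral>\<^sup>+x. h x * indicator unit_cube (x + real_vec m) \<partial>lborel) \<partial>count_space UNIV)"
    by (rule nn_integral_count_space_nn_integral) (auto simp: countableI_type)
  also have "\<dots> = (\<integral>\<^sup>+m. (\<integral>\<^sup>+x. h (x + real_vec m) * indicator unit_cube x \<partial>lborel) \<partial>count_space UNIV)"
  proof -
    have "(\<integral>\<^sup>+x. h x * indicator unit_cube (x + real_vec (- m)) \<partial>lborel) = (\<integral>\<^sup>+x. h (x + real_vec m) * indicator unit_cube x \<partial>lborel)" for m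
      by (subst nn_integral_lborel_translate[where a = "real_vec m", symmetric]) (auto simp: real_vec_minus)
    moreover have flip: "(\<integral>\<^sup>+m. g m \<partial>count_space UNIV) = (\<integral>\<^sup>+m. g (- m) \<partial>count_space UNIV)" for g :: "int ^ 'n \<Rightarrow> ennreal"
      by (rule nn_integral_bij_count_space[symmetric]) (auto intro: bij_betw_byWitness[of _ uminus])
    ultimately show ?thesis
      by (subst flip) simp
  qed
  also have "\<dots> = (\<integral>\<^sup>+x. (\<integral>\<^sup>+m. h (x + real_vec m) * indicator unit_cube x \<partial>count_space UNIV) \<partial>lborel)"
    by (rule nn_integral_count_space_nn_integral[symmetric]) (auto simp: countableI_type)
  also have "\<dots> = (\<integral>\<^sup>+x. (\<integral>\<^sup>+m. h (x + real_vec m) \<partial>count_space UNIV) \<partial>torus)"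
    by (simp add: nn_integral_torus nn_integral_multc)
  finally show ?thesis .
qed

text \<open>
  Translation invariance of the integral over a period: unfold the torus to \<open>\<real>\<^sup>n\<close>, translate there, and fold back
  along the tiling by translated cubes.
\<close>

lemma nn_integral_torus_translate:
  fixes g :: "real ^ 'n \<Rightarrow> ennreal"
  assumes [measurable]: "g \<in> borel_measurable borel" and per: "\<And>x m. g (x + real_vec m) = g x"
  shows "(\<integral>\<^sup>+x. g (x + a) \<partial>torus) = (\<integral>\<^sup>+x. g x \<partial>torus)"
proof -
  have "(\<integral>\<^sup>+x. g (x + a) \<partial>torus) = (\<integral>\<^sup>+x. g (x + a) * indicator unit_cube (x + a - a) \<partial>lborel)"
    by (simp add: nn_integral_torus)
  also have "\<dots> = (\<integral>\<^sup>+x. g x * indicator unit_cube (x - a) \<partial>lborel)"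
    by (rule nn_integral_lborel_translate) measurable
  also have "\<dots> = (\<integral>\<^sup>+x. (\<integral>\<^sup>+m. g x * indicator unit_cube ((x - a) + real_vec m) \<partial>count_space UNIV) \<partial>torus)"
    by (subst nn_integral_lborel_periodize) (auto simp: per algebra_simps)
  also have "\<dots> = (\<integral>\<^sup>+x. g x \<partial>torus)"
    by (simp add: nn_integral_cmult nn_integral_unit_cube_translates)
  finally show ?thesis .
qed

lemma real_vec_inner_Ints: "real_vec k \<bullet> real_vec m \<in> \<int>"
  unfolding real_vec_def inner_vec_def by (auto intro!: Ints_sum)

lemma integrable_torus_bounded:
  fixes f :: "real ^ 'n \<Rightarrow> 'b::{banach, second_countable_topology}"
  assumes "f \<in> borel_measurable borel" "\<And>x. norm (f x) \<le> B"
  shows "integrable torus f"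
  by (rule finite_measure.integrable_const_bound[OF finite_measure_torus, of _ B]) (use assms in auto)

text \<open>
  Translation by half a period in the direction of \<open>k\<close> changes the sign of the cosine but not the integral. The argument is run
  for \<open>1 + cos\<close> and \<open>1 - cos\<close>, to which translation invariance of the nonnegative integral applies.
\<close>

lemma integral_torus_cos_eq_0:
  fixes k :: "int ^ 'n"
  assumes k: "k \<noteq> 0"
  shows "(\<integral>x. cos (2 * pi * (real_vec k \<bullet> x) + t) \<partial>torus) = 0"
proof -
  \<comment> \<open>half a period: \<open>k \<bullet> a = 1/2\<close>\<close>
  define a where "a = (1 / (2 * (real_vec k \<bullet> real_vec k))) *\<^sub>R real_vec k"
  have ka: "real_vec k \<bullet> a = 1/2"
    using k by (simp add: a_def)
  let ?c = "\<lambda>x. cos (2 * pi * (real_vec k \<bullet> x) + t)"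
  have per: "?c (x + real_vec m) = ?c x" for x m
  proof -
    obtain n where n: "real_vec k \<bullet> real_vec m = of_int n"
      using real_vec_inner_Ints[of k m] by (auto elim: Ints_cases)
    have "2 * pi * (real_vec k \<bullet> (x + real_vec m)) + t = (2 * pi * (real_vec k \<bullet> x) + t) + (2 * pi) * of_int n"
      by (simp add: inner_add_right n algebra_simps)
    then show ?thesis by (simp only: cos_add cos_int_2pin sin_int_2pin) simp
  qed
  have anti: "?c (x + a) = - ?c x" for x
  proof -
    have "2 * pi * (real_vec k \<bullet> (x + a)) + t = (2 * pi * (real_vec k \<bullet> x) + t) + pi"
      by (simp add: inner_add_right ka algebra_simps)
    then show ?thesis by (simp only: cos_periodic_pi)
  qed
  have [measurable]: "?c \<in> borel_measurable borel" by measurable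
  have i: "integrable torus ?c"
    by (rule integrable_torus_bounded[where B = 1]) auto
  have ge: "0 \<le> 1 + s * cos u" if "s = 1 \<or> s = -1" for s u :: real
    using that cos_ge_minus_one[of u] cos_le_one[of u] by (elim disjE; hypsubst; linarith)
  have nn: "(\<integral>\<^sup>+x. ennreal (1 + s * ?c x) \<partial>torus) = ennreal (\<integral>x. 1 + s * ?c x \<partial>torus)" if "s = 1 \<or> s = -1" for s
  proof (rule nn_integral_eq_integral)
    show "integrable torus (\<lambda>x. 1 + s * ?c x)"
      by (rule integrable_torus_bounded[where B = 2])
        (use that in \<open>auto intro!: order_trans[OF abs_triangle_ineq] order_trans[OF abs_triangle_ineq4] simp: abs_mult\<close>)
    show "AE x in torus. 0 \<le> 1 + s * ?c x"
      by (intro AE_I2 ge that)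
  qed
  have pos: "0 \<le> (\<integral>x. 1 + s * ?c x \<partial>torus)" if "s = 1 \<or> s = -1" for s
    by (intro Bochner_Integration.integral_nonneg ge that)
  have "(\<integral>\<^sup>+x. ennreal (1 + (-1) * ?c x) \<partial>torus) = (\<integral>\<^sup>+x. ennreal (1 + 1 * ?c (x + a)) \<partial>torus)"
    by (simp only: anti) simp
  also have "\<dots> = (\<integral>\<^sup>+x. ennreal (1 + 1 * ?c x) \<partial>torus)"
    by (rule nn_integral_torus_translate) (auto simp: per)
  finally have eq: "(\<integral>x. 1 + (-1) * ?c x \<partial>torus) = (\<integral>x. 1 + 1 * ?c x \<partial>torus)"
    using nn[of 1] nn[of "-1"] pos[of 1] pos[of "-1"] by simp
  have "(\<integral>x. 1 + s * ?c x \<partial>torus) = (\<integral>x. 1 \<partial>(torus :: (real ^ 'n) measure)) + s * (\<integral>x. ?c x \<partial>torus)" for s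
    using i by (subst Bochner_Integration.integral_add) (auto intro!: integrable_torus_bounded[where B = 1])
  note this[of 1] this[of "-1"]
  with eq show ?thesis by linarith
qed

lemma integral_torus_cis:
  fixes k :: "int ^ 'n"
  shows "(\<integral>x. cis (2 * pi * (real_vec k \<bullet> x)) \<partial>torus) = (if k = 0 then complex_of_real (measure torus (space (torus :: (real ^ 'n) measure))) else 0)"
proof (cases "k = 0")
  case True
  have "(\<integral>x. 1 \<partial>(torus :: (real ^ 'n) measure)) = complex_of_real (measure torus (space (torus :: (real ^ 'n) measure)))"
    by (simp add: scaleR_conv_of_real)
  then show ?thesis by (simp add: True)
next
  case False
  have i: "integrable torus (\<lambda>x. cis (2 * pi * (real_vec k \<bullet> x)))"
    by (rule integrable_torus_bounded[where B = 1]) auto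
  have "sin u = cos (u + (- (pi/2)))" for u :: real
    by (simp add: cos_diff)
  then have "Im (\<integral>x. cis (2 * pi * (real_vec k \<bullet> x)) \<partial>torus) = 0"
    using integral_torus_cos_eq_0[OF False, of "- (pi/2)"] integral_Im[OF i] by simp
  moreover have "Re (\<integral>x. cis (2 * pi * (real_vec k \<bullet> x)) \<partial>torus) = 0"
    using integral_torus_cos_eq_0[OF False, of 0] integral_Re[OF i] by simp
  ultimately show ?thesis using False by (simp add: complex_eq_iff)
qed

text \<open>
  Parseval's identity for trigonometric polynomials; the inequality sign comes from bounding the volume of the
  cube by 1.
\<close>

lemma energy_torus_trigonometric_le:
  fixes A :: "(int ^ 'n) set"
  assumes A: "finite A"
  shows "energy torus (\<lambda>x. \<Sum>k\<in>A. d k * cis (2 * pi * (real_vec k \<bullet> x))) \<le> ennreal (\<Sum>k\<in>A. (cmod (d k))\<^sup>2)"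
proof -
  let ?P = "\<lambda>x. \<Sum>k\<in>A. d k * cis (2 * pi * (real_vec k \<bullet> x))"
  let ?v = "measure torus (space (torus :: (real ^ 'n) measure))"
  have sq: "complex_of_real ((cmod (?P x))\<^sup>2) = (\<Sum>k\<in>A. \<Sum>j\<in>A. d k * cnj (d j) * cis (2 * pi * (real_vec (k - j) \<bullet> x)))" for x
  proof -
    have e: "cis (2 * pi * (real_vec k \<bullet> x)) * cnj (cis (2 * pi * (real_vec j \<bullet> x))) = cis (2 * pi * (real_vec (k - j) \<bullet> x))" for k j
      by (simp add: cis_cnj cis_mult real_vec_diff inner_diff_left right_diff_distrib)
    have "complex_of_real ((cmod (?P x))\<^sup>2) = ?P x * cnj (?P x)"
      by (rule complex_norm_square)
    also have "\<dots> = (\<Sum>k\<in>A. \<Sum>j\<in>A. d k * cnj (d j) * (cis (2 * pi * (real_vec k \<bullet> x)) * cnj (cis (2 * pi * (real_vec j \<bullet> x)))))"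
      by (simp only: cnj_sum complex_cnj_mult sum_product ac_simps)
    finally show ?thesis by (simp only: e)
  qed
  have iP: "integrable torus (\<lambda>x. (cmod (?P x))\<^sup>2)"
  proof (rule integrable_torus_bounded)
    fix x
    have "cmod (?P x) \<le> (\<Sum>k\<in>A. cmod (d k))"
      by (rule order_trans[OF norm_sum]) (simp add: norm_mult)
    then show "norm ((cmod (?P x))\<^sup>2) \<le> (\<Sum>k\<in>A. cmod (d k))\<^sup>2"
      by (simp add: power_mono)
  qed measurable
  have i: "integrable torus (\<lambda>x. c * cis (2 * pi * (real_vec k \<bullet> x)))" for c and k :: "int ^ 'n"
    by (rule integrable_torus_bounded[where B = "cmod c"]) (auto simp: norm_mult)
  have "complex_of_real (\<integral>x. (cmod (?P x))\<^sup>2 \<partial>torus) = (\<integral>x. complex_of_real ((cmod (?P x))\<^sup>2) \<partial>torus)"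
    by (rule integral_complex_of_real[symmetric])
  also have "\<dots> = (\<Sum>k\<in>A. \<Sum>j\<in>A. d k * cnj (d j) * (\<integral>x. cis (2 * pi * (real_vec (k - j) \<bullet> x)) \<partial>torus))"
    unfolding sq using i by simp
  also have "\<dots> = (\<Sum>k\<in>A. \<Sum>j\<in>A. if j = k then d k * cnj (d j) * of_real ?v else 0)"
    unfolding integral_torus_cis by (intro sum.cong refl) auto
  also have "\<dots> = (\<Sum>k\<in>A. d k * cnj (d k) * of_real ?v)"
    using A by simp
  also have "\<dots> = complex_of_real ((\<Sum>k\<in>A. (cmod (d k))\<^sup>2) * ?v)"
    by (simp add: complex_norm_square sum_distrib_right del: of_real_power)
  finally have "(\<integral>x. (cmod (?P x))\<^sup>2 \<partial>torus) = (\<Sum>k\<in>A. (cmod (d k))\<^sup>2) * ?v"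
    by (simp only: of_real_eq_iff)
  also have "\<dots> \<le> (\<Sum>k\<in>A. (cmod (d k))\<^sup>2)"
    using measure_torus_le by (intro mult_left_le sum_nonneg) auto
  finally show ?thesis
    unfolding energy_def by (subst nn_integral_eq_integral[OF iP]) (auto intro: ennreal_leI)
qed

section \<open>Orthogonality of the integer shifts\<close>

lemma has_sum_infsum_ennreal:
  fixes A :: "'a \<Rightarrow> real"
  assumes nn: "\<And>m. 0 \<le> A m" and fin: "(\<Sum>\<^sub>\<infinity>m. ennreal (A m)) < \<infinity>"
  shows "(A has_sum enn2real (\<Sum>\<^sub>\<infinity>m. ennreal (A m))) UNIV"
proof -
  let ?S = "\<Sum>\<^sub>\<infinity>m. ennreal (A m)"
  have S: "?S = (SUP F\<in>{F. finite F \<and> F \<subseteq> UNIV}. sum (\<lambda>m. ennreal (A m)) F)"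
    by (rule nonneg_infsum_complete) simp
  have sum_eq: "sum (\<lambda>m. ennreal (A m)) F = ennreal (sum A F)" for F
    using nn by (simp add: sum_ennreal)
  have "sum A F \<le> enn2real ?S" if "finite F" for F
  proof -
    have "ennreal (sum A F) \<le> ?S"
      unfolding S sum_eq by (rule SUP_upper) (use that in simp)
    then show ?thesis
      using fin by (metis enn2real_ennreal enn2real_mono infinity_ennreal_def nn sum_nonneg)
  qed
  then have summ: "A summable_on UNIV"
    using nn by (intro nonneg_bdd_above_summable_on) (auto simp: bdd_above_def)
  have "ennreal (infsum A UNIV) = ?S"
    unfolding S sum_eq using summ nn by (intro infsum_nonneg_is_SUPREMUM_ennreal) auto
  then have "enn2real ?S = infsum A UNIV"
    using nn by (metis enn2real_ennreal infsum_nonneg)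
  then show ?thesis using summ by simp
qed

lemma nn_integral_count_space_has_sum:
  fixes f :: "'a \<Rightarrow> real"
  assumes f: "(f has_sum S) UNIV" and nn: "\<And>m. 0 \<le> f m"
  shows "(\<integral>\<^sup>+m. ennreal (f m) \<partial>count_space UNIV) = ennreal S"
proof -
  have "Infinite_Sum.abs_summable_on f UNIV"
    using f nn by (auto simp: summable_on_def)
  then have abs: "Infinite_Set_Sum.abs_summable_on f UNIV"
    by (rule abs_summable_equivalent[THEN iffD1])
  then have "integrable (count_space UNIV) f"
    by (simp add: Infinite_Set_Sum.abs_summable_on_def)
  then have "(\<integral>\<^sup>+m. ennreal (f m) \<partial>count_space UNIV) = ennreal (infsetsum f UNIV)"
    using nn by (simp add: nn_integral_eq_integral infsetsum_def)
  also have "infsetsum f UNIV = S"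
    using infsetsum_infsum[OF abs] f by (simp add: infsumI)
  finally show ?thesis .
qed

lemma has_sum_finite_sum:
  fixes f :: "'i \<Rightarrow> 'a \<Rightarrow> 'b::topological_comm_monoid_add"
  assumes "finite I" "\<And>i. i \<in> I \<Longrightarrow> (f i has_sum s i) A"
  shows "((\<lambda>x. \<Sum>i\<in>I. f i x) has_sum (\<Sum>i\<in>I. s i)) A"
  using assms by (induction I rule: finite_induct) (auto intro!: has_sum_add)

lemma norm_L2_sum_square:
  assumes L: "\<And>l. l \<in> L \<Longrightarrow> g l \<in> L2_space M"
  shows "complex_of_real ((norm_L2 M (\<lambda>x. \<Sum>l\<in>L. p l * g l x))\<^sup>2)
    = (\<Sum>l\<in>L. \<Sum>j\<in>L. p l * cnj (p j) * (\<integral>x. g l x * cnj (g j x) \<partial>M))"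
proof -
  have "complex_of_real ((norm_L2 M (\<lambda>x. \<Sum>l\<in>L. p l * g l x))\<^sup>2)
     = complex_of_real (\<integral>x. (cmod (\<Sum>l\<in>L. p l * g l x))\<^sup>2 \<partial>M)"
    by (simp add: norm_L2_def)
  also have "\<dots> = (\<integral>x. complex_of_real ((cmod (\<Sum>l\<in>L. p l * g l x))\<^sup>2) \<partial>M)"
    by (rule integral_complex_of_real[symmetric])
  also have "\<dots> = (\<integral>x. (\<Sum>l\<in>L. \<Sum>j\<in>L. p l * cnj (p j) * (g l x * cnj (g j x))) \<partial>M)"
    unfolding complex_norm_square by (simp only: cnj_sum complex_cnj_mult sum_product ac_simps)
  also have "\<dots> = (\<Sum>l\<in>L. \<Sum>j\<in>L. p l * cnj (p j) * (\<integral>x. g l x * cnj (g j x) \<partial>M))"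
    using L2_product_integrable[OF L L] by simp
  finally show ?thesis .
qed

text \<open>
  The sequences \<open>m \<mapsto> \<kappa> (m + l)\<close>, one for each \<open>l\<close>, are vectors of the Hilbert space of square summable sequences
  with values in \<open>L\<^sup>2(M)\<close>. The hypothesis says that they are pairwise orthogonal, and they all have squared norm \<open>W\<close>;
  the claim is the Pythagorean theorem.
\<close>

lemma orthogonal_translates_energy:
  fixes \<kappa> :: "int ^ 'n \<Rightarrow> 'a \<Rightarrow> complex"
  assumes meas: "\<And>m. \<kappa> m \<in> borel_measurable M"
    and W: "W = (\<Sum>\<^sub>\<infinity>m. energy M (\<kappa> m))" "W < \<infinity>"
    and ortho: "\<And>l. l \<noteq> 0 \<Longrightarrow> ((\<lambda>m. \<integral>x. \<kappa> m x * cnj (\<kappa> (m + l) x) \<partial>M) has_sum 0) UNIV"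
    and L: "finite L"
  shows "(\<integral>\<^sup>+m. energy M (\<lambda>x. \<Sum>l\<in>L. p l * \<kappa> (m + l) x) \<partial>count_space UNIV) = ennreal (\<Sum>l\<in>L. (cmod (p l))\<^sup>2) * W"
proof -
  have "energy M (\<kappa> m) \<le> W" for m
  proof -
    have "W = (SUP F\<in>{F. finite F \<and> F \<subseteq> UNIV}. sum (\<lambda>m. energy M (\<kappa> m)) F)"
      unfolding W by (rule nonneg_infsum_complete) simp
    moreover have "sum (\<lambda>m. energy M (\<kappa> m)) {m} \<le> \<dots>" by (rule SUP_upper) simp
    ultimately show ?thesis by simp
  qed
  then have L2: "\<kappa> m \<in> L2_space M" for m
    using W(2) by (auto simp: L2_space_iff_energy meas intro: le_less_trans)
  define A where "A m = (norm_L2 M (\<kappa> m))\<^sup>2" for m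
  have enA: "energy M (\<kappa> m) = ennreal (A m)" for m
    unfolding A_def by (rule energy_eq_norm_L2[OF L2])
  have A: "(A has_sum enn2real W) UNIV"
    using has_sum_infsum_ennreal[of A] W by (simp add: enA A_def)
  have shift: "bij (\<lambda>m. m + l)" for l :: "int ^ 'n"
    by (auto intro: bij_betw_byWitness[of _ "\<lambda>m. m - l"])
  have gram: "((\<lambda>m. \<integral>x. \<kappa> (m + l) x * cnj (\<kappa> (m + j) x) \<partial>M) has_sum (if l = j then of_real (enn2real W) else 0)) UNIV" for l j
  proof (cases "l = j")
    case True
    have "(\<integral>x. \<kappa> (m + l) x * cnj (\<kappa> (m + l) x) \<partial>M) = complex_of_real (A (m + l))" for m
      using norm_L2_sum_square[of "{()}" "\<lambda>_. \<kappa> (m + l)" M "\<lambda>_. 1"] L2 by (simp add: A_def)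
    moreover have "((\<lambda>m. A (m + l)) has_sum enn2real W) UNIV"
      using has_sum_reindex_bij_betw[OF shift, of A] A by simp
    ultimately show ?thesis
      using True has_sum_of_real[where 'a = complex] by simp
  next
    case False
    have "((\<lambda>m. \<integral>x. \<kappa> (m + l) x * cnj (\<kappa> (m + l + (j - l)) x) \<partial>M) has_sum 0) UNIV"
      using has_sum_reindex_bij_betw[OF shift[of l], of "\<lambda>m. \<integral>x. \<kappa> m x * cnj (\<kappa> (m + (j - l)) x) \<partial>M"]
        ortho[of "j - l"] False by simp
    then show ?thesis using False by simp
  qed
  let ?v = "\<lambda>m x. \<Sum>l\<in>L. p l * \<kappa> (m + l) x"
  have vL2: "?v m \<in> L2_space M" for m by (intro L2_sum L2_cmult L2)
  have "((\<lambda>m. \<Sum>l\<in>L. \<Sum>j\<in>L. p l * cnj (p j) * (\<integral>x. \<kappa> (m + l) x * cnj (\<kappa> (m + j) x) \<partial>M))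
     has_sum (\<Sum>l\<in>L. \<Sum>j\<in>L. p l * cnj (p j) * (if l = j then of_real (enn2real W) else 0))) UNIV"
    by (intro has_sum_finite_sum L has_sum_cmult_right gram)
  also have "(\<lambda>m. \<Sum>l\<in>L. \<Sum>j\<in>L. p l * cnj (p j) * (\<integral>x. \<kappa> (m + l) x * cnj (\<kappa> (m + j) x) \<partial>M))
     = (\<lambda>m. complex_of_real ((norm_L2 M (?v m))\<^sup>2))"
    by (intro ext norm_L2_sum_square[symmetric] L2)
  also have "(\<Sum>l\<in>L. \<Sum>j\<in>L. p l * cnj (p j) * (if l = j then of_real (enn2real W) else 0))
     = complex_of_real ((\<Sum>l\<in>L. (cmod (p l))\<^sup>2) * enn2real W)"
  proof -
    have "(\<Sum>j\<in>L. p l * cnj (p j) * (if l = j then of_real (enn2real W) else 0)) = complex_of_real ((cmod (p l))\<^sup>2 * enn2real W)" if "l \<in> L" for l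
      using L that by (simp add: if_distrib[of "\<lambda>x. _ * x"] complex_norm_square del: of_real_power cong: if_cong)
    then show ?thesis by (simp add: sum_distrib_right)
  qed
  finally have "((\<lambda>m. (norm_L2 M (?v m))\<^sup>2) has_sum ((\<Sum>l\<in>L. (cmod (p l))\<^sup>2) * enn2real W)) UNIV"
    by (simp only: has_sum_of_real_iff)
  from nn_integral_count_space_has_sum[OF this]
  have "(\<integral>\<^sup>+m. energy M (?v m) \<partial>count_space UNIV) = ennreal ((\<Sum>l\<in>L. (cmod (p l))\<^sup>2) * enn2real W)"
    by (simp add: energy_eq_norm_L2[OF vL2])
  also have "\<dots> = ennreal (\<Sum>l\<in>L. (cmod (p l))\<^sup>2) * W"
    using W(2) by (simp add: ennreal_mult sum_nonneg)
  finally show ?thesis .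
qed

section \<open>The Bessel bound\<close>

text \<open>
  The trigonometric polynomial that multiplies the \<open>l\<close>-th integer shift of the kernel, after the terms of a synthesis
  have been collected according to \<open>l\<close>.
\<close>

definition layer_polynomial :: "(int ^ 'n) set \<Rightarrow> ((int ^ 'n) \<times> (int ^ 'n) \<Rightarrow> complex) \<Rightarrow> int ^ 'n \<Rightarrow> real ^ 'n \<Rightarrow> complex" where
  "layer_polynomial A c l \<xi> = (\<Sum>k\<in>A. c (k, l) * cis (pi * (real_vec k \<bullet> real_vec l)) * cis (2 * pi * (real_vec k \<bullet> \<xi>)))"

lemma layer_polynomial_measurable [measurable]: "layer_polynomial A c l \<in> borel_measurable borel"
  unfolding layer_polynomial_def[abs_def] by measurable

lemma layer_polynomial_periodic: "layer_polynomial A c l (\<xi> + real_vec m) = layer_polynomial A c l \<xi>"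
  unfolding layer_polynomial_def
proof (intro sum.cong refl arg_cong2[where f = "(*)"])
  fix k
  obtain n where n: "real_vec k \<bullet> real_vec m = of_int n"
    using real_vec_inner_Ints[of k m] by (auto elim: Ints_cases)
  have "cis (2 * pi * (real_vec k \<bullet> (\<xi> + real_vec m))) = cis (2 * pi * (real_vec k \<bullet> \<xi>)) * cis (2 * pi * of_int n)"
    by (simp only: cis_mult inner_add_right n distrib_left)
  then show "cis (2 * pi * (real_vec k \<bullet> (\<xi> + real_vec m))) = cis (2 * pi * (real_vec k \<bullet> \<xi>))"
    by (simp only: cis_multiple_2pi[OF Ints_of_int] mult_1_right)
qed

lemma energy_torus_layer_polynomial_le:
  assumes "finite A"
  shows "energy torus (layer_polynomial A c l) \<le> ennreal (\<Sum>k\<in>A. (cmod (c (k, l)))\<^sup>2)"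
  using energy_torus_trigonometric_le[OF assms, of "\<lambda>k. c (k, l) * cis (pi * (real_vec k \<bullet> real_vec l))"]
  by (simp add: layer_polynomial_def[abs_def] norm_mult)

lemma sum_kernel_shift_eq_layers:
  "(\<Sum>p\<in>A \<times> L. c p * kernel_shift p K (\<xi>, \<eta>)) = (\<Sum>l\<in>L. layer_polynomial A c l \<xi> * K (\<xi> + real_vec l, \<eta>))"
proof -
  have "(\<Sum>p\<in>A \<times> L. c p * kernel_shift p K (\<xi>, \<eta>)) = (\<Sum>k\<in>A. \<Sum>l\<in>L. c (k, l) * kernel_shift (k, l) K (\<xi>, \<eta>))"
    by (simp add: sum.cartesian_product)
  also have "\<dots> = (\<Sum>l\<in>L. \<Sum>k\<in>A. c (k, l) * kernel_shift (k, l) K (\<xi>, \<eta>))"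
    by (rule sum.swap)
  also have "\<dots> = (\<Sum>l\<in>L. layer_polynomial A c l \<xi> * K (\<xi> + real_vec l, \<eta>))"
  proof -
    have "cis (pi * (s + 2 * t)) = cis (pi * s) * cis (2 * pi * t)" for s t
      by (simp add: cis_mult algebra_simps)
    then show ?thesis
      unfolding layer_polynomial_def sum_distrib_right
      by (intro sum.cong refl) (simp add: kernel_shift_def modulated_shift_def mult.assoc)
  qed
  finally show ?thesis .
qed

text \<open>
  Fold the integral over \<open>\<xi>\<close> to the torus. The layer polynomials are periodic, hence constant on each orbit of
  \<open>\<int>\<^sup>n\<close>, and by condition C the fibre over \<open>\<xi>\<close> contributes \<open>w(\<xi>)\<close> times the sum of their squared
  moduli. It remains to bound \<open>w\<close> by \<open>b\<close> and to integrate the squared moduli over the torus.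
\<close>

lemma kernel_synthesis_bound:
  fixes \<phi> :: "(real ^ 'n) \<times> (real ^ 'n) \<Rightarrow> complex"
  assumes \<phi>: "\<phi> \<in> L2_space lborel" and C: "condition_C \<phi>"
    and w: "AE \<xi> in torus. w_fun \<phi> \<xi> \<le> ennreal b" and A: "finite A" and L: "finite L" and b: "0 \<le> b"
  shows "energy lborel (\<lambda>z. \<Sum>p\<in>A \<times> L. c p * kernel_shift p (weyl_kernel \<phi>) z) \<le> ennreal (b * (\<Sum>p\<in>A \<times> L. (cmod (c p))\<^sup>2))"
proof -
  define K where "K = weyl_kernel \<phi>"
  let ?P = "layer_polynomial A c"
  have "K \<in> L2_space lborel"
    using weyl_kernel_tendsto[OF \<phi>] unfolding K_def tendsto_L2_def by blast
  then have [measurable]: "K \<in> borel_measurable borel" using L2_spaceD by fastforce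
  have wK: "w_fun \<phi> \<xi> = (\<Sum>\<^sub>\<infinity>m. energy lborel (\<lambda>\<eta>. K (\<xi> + real_vec m, \<eta>)))" for \<xi>
    by (simp add: w_fun_def K_def energy_def)
  define h where "h \<xi> = energy lborel (\<lambda>\<eta>. \<Sum>l\<in>L. ?P l \<xi> * K (\<xi> + real_vec l, \<eta>))" for \<xi>
  have hm [measurable]: "h \<in> borel_measurable borel"
    unfolding h_def[abs_def] energy_def by measurable
  have ortho: "AE \<xi> in torus. \<forall>l. l \<noteq> 0 \<longrightarrow> ((\<lambda>m. \<integral>\<eta>. K (\<xi> + real_vec m, \<eta>) * cnj (K (\<xi> + real_vec (m + l), \<eta>)) \<partial>lborel) has_sum 0) UNIV"
    using C unfolding condition_C_def AE_all_countable K_def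
    by (auto simp: real_vec_add add.assoc[symmetric] intro: AE_impI)
  have "energy lborel (\<lambda>z. \<Sum>p\<in>A \<times> L. c p * kernel_shift p K z) = (\<integral>\<^sup>+\<xi>. h \<xi> \<partial>lborel)"
  proof (subst energy_fst)
    show "(\<lambda>z. \<Sum>p\<in>A \<times> L. c p * kernel_shift p K z) \<in> borel_measurable borel"
    proof (intro borel_measurable_sum borel_measurable_times)
      fix p :: "(int ^ 'n) \<times> (int ^ 'n)"
      show "kernel_shift p K \<in> borel_measurable borel"
        unfolding kernel_shift_def by (cases p) (simp only: prod.case, rule modulated_shift_measurable, measurable)
    qed auto
  qed (simp only: h_def[abs_def] sum_kernel_shift_eq_layers)
  also have "\<dots> = (\<integral>\<^sup>+\<xi>. (\<integral>\<^sup>+m. h (\<xi> + real_vec m) \<partial>count_space UNIV) \<partial>torus)"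
    by (rule nn_integral_lborel_periodize) measurable
  also have "\<dots> \<le> (\<integral>\<^sup>+\<xi>. ennreal b * ennreal (\<Sum>l\<in>L. (cmod (?P l \<xi>))\<^sup>2) \<partial>torus)"
  proof (rule nn_integral_mono_AE)
    show "AE \<xi> in torus. (\<integral>\<^sup>+m. h (\<xi> + real_vec m) \<partial>count_space UNIV) \<le> ennreal b * ennreal (\<Sum>l\<in>L. (cmod (?P l \<xi>))\<^sup>2)"
      using w ortho
    proof eventually_elim
      case (elim \<xi>)
      have "h (\<xi> + real_vec m) = energy lborel (\<lambda>\<eta>. \<Sum>l\<in>L. ?P l \<xi> * K (\<xi> + real_vec (m + l), \<eta>))" for m
        by (simp add: h_def layer_polynomial_periodic real_vec_add add.assoc)
      then have "(\<integral>\<^sup>+m. h (\<xi> + real_vec m) \<partial>count_space UNIV) = ennreal (\<Sum>l\<in>L. (cmod (?P l \<xi>))\<^sup>2) * w_fun \<phi> \<xi>"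
        using elim(2) le_less_trans[OF elim(1)]
        by (simp only:) (rule orthogonal_translates_energy[where \<kappa> = "\<lambda>m \<eta>. K (\<xi> + real_vec m, \<eta>)"], auto simp: wK L)
      also have "\<dots> \<le> ennreal (\<Sum>l\<in>L. (cmod (?P l \<xi>))\<^sup>2) * ennreal b"
        by (intro mult_left_mono elim(1)) auto
      finally show ?case by (simp add: mult.commute)
    qed
  qed
  also have "\<dots> = ennreal b * (\<Sum>l\<in>L. energy torus (?P l))"
    unfolding energy_def by (simp add: nn_integral_cmult nn_integral_sum flip: sum_ennreal)
  also have "\<dots> \<le> ennreal b * (\<Sum>l\<in>L. ennreal (\<Sum>k\<in>A. (cmod (c (k, l)))\<^sup>2))"
    by (intro mult_left_mono sum_mono energy_torus_layer_polynomial_le A) auto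
  also have "\<dots> = ennreal (b * (\<Sum>l\<in>L. \<Sum>k\<in>A. (cmod (c (k, l)))\<^sup>2))"
    using b by (simp add: ennreal_mult sum_nonneg)
  also have "(\<Sum>l\<in>L. \<Sum>k\<in>A. (cmod (c (k, l)))\<^sup>2) = (\<Sum>p\<in>A \<times> L. (cmod (c p))\<^sup>2)"
    by (subst sum.swap) (simp add: sum.cartesian_product)
  finally show ?thesis unfolding K_def .
qed

lemma L2_twisted_translation:
  assumes "f \<in> L2_space lborel" shows "twisted_translation p f \<in> L2_space lborel"
  by (cases p) (simp only: twisted_translation_eq_modulated_shift, rule L2_modulated_shift, measurable, rule assms)

text \<open>
  An arbitrary finite index set is enclosed in a product by setting the missing coefficients to \<open>0\<close>.
\<close>

theorem twisted_translation_Bessel: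
  fixes \<phi> :: "(real ^ 'n) \<times> (real ^ 'n) \<Rightarrow> complex"
  assumes \<phi>: "\<phi> \<in> L2_space lborel" and C: "condition_C \<phi>"
    and w: "AE \<xi> in torus. w_fun \<phi> \<xi> \<le> ennreal b" and b: "0 \<le> b" and F: "finite F"
  shows "(norm_L2 lborel (\<lambda>z. \<Sum>p\<in>F. c p * twisted_translation p \<phi> z))\<^sup>2 \<le> b * (\<Sum>p\<in>F. (cmod (c p))\<^sup>2)"
proof -
  define c' where "c' p = (if p \<in> F then c p else 0)" for p
  let ?R = "fst ` F \<times> snd ` F"
  have sub: "F \<subseteq> ?R" by force
  have R: "finite ?R" using F by simp
  have ext: "(\<Sum>p\<in>?R. c' p * g p) = (\<Sum>p\<in>F. c p * g p)" for g
    by (rule sum.mono_neutral_cong_right) (use R sub in \<open>auto simp: c'_def\<close>)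
  have ext2: "(\<Sum>p\<in>?R. (cmod (c' p))\<^sup>2) = (\<Sum>p\<in>F. (cmod (c p))\<^sup>2)"
    by (rule sum.mono_neutral_cong_right) (use R sub in \<open>auto simp: c'_def\<close>)
  have KL: "weyl_kernel \<phi> \<in> L2_space lborel"
    using weyl_kernel_tendsto[OF \<phi>] unfolding tendsto_L2_def by blast
  have "kernel_shift p (weyl_kernel \<phi>) \<in> L2_space lborel" for p
    unfolding kernel_shift_def by (cases p) (simp only: prod.case, rule L2_modulated_shift, measurable, rule KL)
  then have S: "(\<lambda>z. \<Sum>p\<in>?R. c' p * kernel_shift p (weyl_kernel \<phi>) z) \<in> L2_space lborel"
    by (intro L2_sum L2_cmult)
  have "ennreal ((norm_L2 lborel (\<lambda>z. \<Sum>p\<in>?R. c' p * kernel_shift p (weyl_kernel \<phi>) z))\<^sup>2) \<le> ennreal (b * (\<Sum>p\<in>?R. (cmod (c' p))\<^sup>2))"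
    unfolding energy_eq_norm_L2[OF S, symmetric] by (intro kernel_synthesis_bound \<phi> C w b finite_imageI F)
  then have "(norm_L2 lborel (\<lambda>z. \<Sum>p\<in>?R. c' p * kernel_shift p (weyl_kernel \<phi>) z))\<^sup>2 \<le> b * (\<Sum>p\<in>?R. (cmod (c' p))\<^sup>2)"
    using b by (subst (asm) ennreal_le_iff) (auto intro!: mult_nonneg_nonneg sum_nonneg)
  then show ?thesis
    unfolding norm_L2_sum_twisted_translation[OF F \<phi>] ext ext2 .
qed

section \<open>From a Bessel bound to a Hilbertian family\<close>

lemma finite_int_cube: "finite (int_cube N :: (int ^ 'd) set)"
proof -
  have "int_cube N \<subseteq> vec_lambda ` (PiE UNIV (\<lambda>_ :: 'd. {- int N..int N}))"
  proof
    fix j :: "int ^ 'd" assume "j \<in> int_cube N"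
    then have "\<bar>j $ i\<bar> \<le> int N" for i by (simp add: int_cube_def)
    then have "- int N \<le> j $ i \<and> j $ i \<le> int N" for i by (metis abs_le_D1 abs_le_D2 minus_le_iff)
    then have "vec_nth j \<in> PiE UNIV (\<lambda>_. {- int N..int N})" by (simp add: PiE_UNIV_domain)
    then show "j \<in> vec_lambda ` (PiE UNIV (\<lambda>_. {- int N..int N}))"
      by (metis image_eqI vec_lambda_eta)
  qed
  then show ?thesis
    by (rule finite_subset) (intro finite_imageI finite_PiE, auto)
qed

lemma int_cube_mono: "M \<le> N \<Longrightarrow> int_cube M \<subseteq> int_cube N"
  unfolding int_cube_def by (intro Collect_mono impI allI) (meson of_nat_le_iff order_trans)

lemma finite_subset_int_cube:
  assumes "finite F" shows "\<exists>N. F \<subseteq> int_cube N"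
  using assms
proof (induction F rule: finite_induct)
  case (insert j F)
  then obtain N where N: "F \<subseteq> int_cube N" by blast
  define M where "M = nat (\<Sum>i\<in>UNIV. \<bar>j $ i\<bar>)"
  have "\<bar>j $ i\<bar> \<le> (\<Sum>i\<in>UNIV. \<bar>j $ i\<bar>)" for i by (rule member_le_sum) auto
  then have "j \<in> int_cube M" by (simp add: int_cube_def M_def sum_nonneg)
  then have "insert j F \<subseteq> int_cube (max M N)"
    using N int_cube_mono[of M "max M N"] int_cube_mono[of N "max M N"] by auto
  then show ?case by blast
qed simp

text \<open>
  The Bessel bound makes the partial sums over cubes Cauchy, because the tails of \<open>\<Sum>|c\<^sub>j|\<^sup>2\<close> over finite sets outside
  a large cube are small.
\<close>

theorem hilbertian_of_Bessel:
  fixes f :: "int ^ 'd \<Rightarrow> 'a \<Rightarrow> complex"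
  assumes L2: "\<And>j. f j \<in> L2_space M" and b: "0 \<le> b"
    and Bessel: "\<And>c F. finite F \<Longrightarrow> (norm_L2 M (\<lambda>x. \<Sum>j\<in>F. c j * f j x))\<^sup>2 \<le> b * (\<Sum>j\<in>F. (cmod (c j))\<^sup>2)"
  shows "hilbertian M f"
  unfolding hilbertian_def
proof (intro conjI allI impI)
  fix c :: "int ^ 'd \<Rightarrow> complex"
  assume summ: "(\<lambda>j. (cmod (c j))\<^sup>2) summable_on UNIV"
  define S where "S N x = (\<Sum>j\<in>int_cube N. c j * f j x)" for N x
  have SL: "S N \<in> L2_space M" for N
    unfolding S_def by (intro L2_sum L2_cmult L2)
  have "\<exists>g. g \<in> L2_space M \<and> (\<lambda>N. norm_L2 M (\<lambda>x. S N x - g x)) \<longlonglongrightarrow> 0"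
  proof (rule L2_complete[OF SL])
    fix e :: real assume e: "0 < e"
    \<comment> \<open>\<open>b + 1\<close> in place of \<open>b\<close>, which may be \<open>0\<close>\<close>
    define d where "d = (e/2)\<^sup>2 / (b + 1)"
    have d: "0 < d" using e b by (simp add: d_def)
    let ?q = "\<lambda>j. (cmod (c j))\<^sup>2"
    obtain F0 where F0: "finite F0" "dist (sum ?q F0) (infsum ?q UNIV) \<le> d"
      using infsum_finite_approximation[OF summ d] by blast
    obtain N where N: "F0 \<subseteq> int_cube N" using finite_subset_int_cube[OF F0(1)] by blast
    have tail: "norm_L2 M (\<lambda>x. S m x - S N x) \<le> e/2" if m: "m \<ge> N" for m
    proof -
      let ?D = "int_cube m - int_cube N"
      have D: "finite ?D" by (simp add: finite_int_cube)
      have "sum ?q ?D + sum ?q F0 = sum ?q (?D \<union> F0)"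
        using D F0 N by (intro sum.union_disjoint[symmetric]) auto
      also have "\<dots> \<le> infsum ?q UNIV"
        by (rule finite_sum_le_infsum[OF summ]) (use D F0(1) in simp_all)
      finally have "sum ?q ?D \<le> d" using F0(2) by (simp add: dist_real_def)
      have eq: "(\<lambda>x. S m x - S N x) = (\<lambda>x. \<Sum>j\<in>?D. c j * f j x)"
        unfolding S_def by (rule ext, rule sum_diff[OF finite_int_cube int_cube_mono[OF m], symmetric])
      have "(norm_L2 M (\<lambda>x. S m x - S N x))\<^sup>2 \<le> b * sum ?q ?D"
        unfolding eq by (rule Bessel[OF D])
      also have "\<dots> \<le> (b + 1) * d"
        by (rule mult_mono[OF _ \<open>sum ?q ?D \<le> d\<close>]) (use b in \<open>auto intro!: sum_nonneg\<close>)
      also have "\<dots> = (e/2)\<^sup>2" using b by (simp add: d_def)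
      finally show ?thesis by (rule power2_le_imp_le) (use e in simp)
    qed
    have "norm_L2 M (\<lambda>x. S m x - S n x) \<le> e" if "m \<ge> N" "n \<ge> N" for m n
    proof -
      have "norm_L2 M (\<lambda>x. S m x - S n x) \<le> norm_L2 M (\<lambda>x. S m x - S N x) + norm_L2 M (\<lambda>x. S N x - S n x)"
        by (intro norm_L2_triangle_diff SL)
      also have "norm_L2 M (\<lambda>x. S N x - S n x) = norm_L2 M (\<lambda>x. S n x - S N x)"
        by (rule norm_L2_minus_commute)
      finally show ?thesis using tail[OF that(1)] tail[OF that(2)] by simp
    qed
    then show "\<exists>N. \<forall>m\<ge>N. \<forall>n\<ge>N. norm_L2 M (\<lambda>x. S m x - S n x) \<le> e" by blast
  qed
  then obtain g where g: "g \<in> L2_space M" "(\<lambda>N. norm_L2 M (\<lambda>x. S N x - g x)) \<longlonglongrightarrow> 0" by blast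
  have "tendsto_L2 M S g sequentially"
    unfolding tendsto_L2_def by (intro conjI allI SL g)
  then show "\<exists>g. tendsto_L2 M (\<lambda>N x. \<Sum>j\<in>int_cube N. c j * f j x) g sequentially"
    unfolding S_def[abs_def] by blast
qed (rule L2)

theorem theorem5p2:
  fixes \<phi> :: "(real ^ 'n) \<times> (real ^ 'n) \<Rightarrow> complex"
  assumes "\<phi> \<in> L2_space lborel"
    and "condition_C \<phi>"
    and "L1_ennreal torus (\<lambda>\<xi>. 1 / w_fun \<phi> \<xi>)"
    and "esssup torus (w_fun \<phi>) < \<infinity>"
  shows "hilbertian lborel
    (\<lambda>j :: int ^ ('n + 'n). twisted_translation (\<chi> i. j $ Inl i, \<chi> i. j $ Inr i) \<phi>)"
proof -
  let ?J = "\<lambda>j :: int ^ ('n + 'n). ((\<chi> i. j $ Inl i) :: int ^ 'n, (\<chi> i. j $ Inr i) :: int ^ 'n)"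
  obtain b where b: "0 \<le> b" "esssup torus (w_fun \<phi>) = ennreal b"
    using assms(4) by (cases "esssup torus (w_fun \<phi>)") auto
  have w: "AE \<xi> in torus. w_fun \<phi> \<xi> \<le> ennreal b"
    using esssup_AE[of "w_fun \<phi>" torus] by (simp add: b)
  have inj: "inj ?J"
  proof (rule injI)
    fix x y assume eq: "?J x = ?J y"
    have "x $ i = y $ i" for i
      using eq by (cases i) (auto simp: vec_eq_iff)
    then show "x = y" by (simp add: vec_eq_iff)
  qed
  show ?thesis
  proof (rule hilbertian_of_Bessel[OF _ b(1)])
    show "twisted_translation (?J j) \<phi> \<in> L2_space lborel" for j
      by (rule L2_twisted_translation[OF assms(1)])
    fix c :: "int ^ ('n + 'n) \<Rightarrow> complex" and F :: "(int ^ ('n + 'n)) set"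
    assume F: "finite F"
    have J: "inj_on ?J F" using inj by (rule inj_on_subset) simp
    have r1: "(\<Sum>p\<in>?J ` F. g p) = (\<Sum>j\<in>F. g (?J j))" for g :: "(int ^ 'n) \<times> (int ^ 'n) \<Rightarrow> complex"
      by (simp only: sum.reindex[OF J] o_def)
    have r2: "(\<Sum>p\<in>?J ` F. g p) = (\<Sum>j\<in>F. g (?J j))" for g :: "(int ^ 'n) \<times> (int ^ 'n) \<Rightarrow> real"
      by (simp only: sum.reindex[OF J] o_def)
    have "(norm_L2 lborel (\<lambda>z. \<Sum>p\<in>?J ` F. c (inv ?J p) * twisted_translation p \<phi> z))\<^sup>2 \<le> b * (\<Sum>p\<in>?J ` F. (cmod (c (inv ?J p)))\<^sup>2)"
      by (rule twisted_translation_Bessel[OF assms(1,2) w b(1)]) (use F in simp)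
    then show "(norm_L2 lborel (\<lambda>z. \<Sum>j\<in>F. c j * twisted_translation (?J j) \<phi> z))\<^sup>2 \<le> b * (\<Sum>j\<in>F. (cmod (c j))\<^sup>2)"
      unfolding r1 r2 inv_f_f[OF inj] .
  qed
qed

end
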